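(* Let $R$ be a finitely generated $\mathbb{Z}_{\geq 0}$-semiring. Assume that all two-sided cells in $R$ are strongly regular and idempotent. Then every minimal proper $R$-semimodule is isomorphic to a quotient of a cell semimodule $C_{\mathcal{L}}$, for some left cell $\mathcal{L}$ of $R$. Conversely, every non-zero quotient of a cell semimodule is minimal.
   Context: A semiring is a tuple $(R,+,\cdot,0,1)$ where $(R,+,0)$ is a commutative monoid, $(R,\cdot,1)$ is a monoid, multiplication distributes over addition on both sides, and $0a=a0=0$ for all $a\in R$. A (left) $R$-semimodule is a commutative monoid $(M,+,0_M)$ with a map $R\times M\to M$, $(r,m)\mapsto r(m)$, such that $r(m+n)=r(m)+r(n)$, $r(0_M)=0_M$, $(r+s)(m)=r(m)+s(m)$, $(rs)(m)=r(s(m))$, $0(m)=0_M$, $1(m)=m$. It is called an $R$-module if $M$ is an abelian group, and a proper semimodule if it is not a module. A subsemimodule is a submonoid closed under the action of $R$. An $R$-congruence on $M$ is an equivalence relation $\sim$ such that $m\sim n$ implies $m+k\sim n+k$ for all $k\in M$ and $r(m)\sim r(n)$ for all $r\in R$; a quotient of $M$ is an $R$-semimodule $M/\sim$ for such $\sim$. A non-zero $R$-semimodule $M$ is called minimal if its only subsemimodules are $\{0_M\}$ and $M$. A finitely generated $\mathbb{Z}_{\geq 0}$-semiring is a semiring $R$ containing a finite $\mathbb{Z}_{\geq 0}$-basis $\mathbf{r}=\{r_1,\dots,r_k\}$, i.e. every element of $R$ can be written uniquely as a linear combination of elements of $\mathbf{r}$ with coefficients in $\mathbb{Z}_{\geq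 0}$ (such a basis is unique). Cells. For $r_i,r_j\in\mathbf{r}$ write $r_i\leq_L r_j$ if there is $r\in R$ such that the coefficient of $r_j$ in $rr_i$ is non-zero; this is a pre-order, and its equivalence classes (on $\mathbf{r}$) are the left cells. The right pre-order $\leq_R$ and right cells are defined similarly using $r_ir$, and the two-sided pre-order $\leq_J$ and two-sided cells using $rr_ir'$ with $r,r'\in R$. A two-sided cell $\mathcal{J}$ is strongly regular if the intersection of any left cell and any right cell inside $\mathcal{J}$ is a singleton; it is idempotent if it contains (not necessarily distinct) elements $x,y,z$ such that $xy$ has a non-zero coefficient at $z$. Cell semimodules. Let $\rho$ be the congruence on $R$ under which $\sum_i a_ir_i$ and $\sum_i a_i'r_i$ are related iff, for all $i$, $a_i\neq 0\Leftrightarrow a_i'\neq 0$. The quotient $\tilde{R}=R/\rho$ is a semiring over the Boolean semiring $\mathbf{B}=\{0,1\}$ (with $1+1=1$) with basis the classes of the $r_i$, again denoted $r_i$. For a left cell $\mathcal{L}$, let $C_{\mathcal{L}}$ be the additive submonoid of $\tilde{R}$ generated by the $r_i\in\mathcal{L}$, and $\pi_{\mathcal{L}}:\tilde{R}\to C_{\mathcal{L}}$ the projection $\sum_i a_ir_i\mapsto\sum_{r_i\in\mathcal{L}}a_ir_i$. Then $r\cdot x:=\pi_{\mathcal{L}}(rx)$, $r\in\tilde{R}$, $x\in C_{\mathcal{L}}$, makes $C_{\mathcal{L}}$ an $\tilde{R}$-semimodule, and, via the projection $R\to\tilde{R}$, an $R$-semimodule, called the cell semimodule corresponding to $\mathcal{L}$.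 *)

theory Defs
  imports "HOL-Algebra.Module"
begin

section \<open>Semimodules\<close>

text \<open>As for modules in the library, a semimodule is a record of type \<^typ>\<open>('a, 'm) module\<close> whose
  fields \<open>mult\<close> and \<open>one\<close> carry no meaning.  The library locale \<open>module\<close> itself requires a
  commutative ring, and is therefore not used.\<close>

locale semimodule = R?: semiring R + M?: abelian_monoid M for R (structure) and M (structure) +
  assumes smult_closed:
      "\<lbrakk>r \<in> carrier R; x \<in> carrier M\<rbrakk> \<Longrightarrow> r \<odot>\<^bsub>M\<^esub> x \<in> carrier M"
    and smult_r_distr:
      "\<lbrakk>r \<in> carrier R; x \<in> carrier M; y \<in> carrier M\<rbrakk> \<Longrightarrow>
        r \<odot>\<^bsub>M\<^esub> (x \<oplus>\<^bsub>M\<^esub> y) = r \<odot>\<^bsub>M\<^esub> x \<oplus>\<^bsub>M\<^esub> r \<odot>\<^bsub>M\<^esub> y"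
    and smult_r_null:
      "r \<in> carrier R \<Longrightarrow> r \<odot>\<^bsub>M\<^esub> \<zero>\<^bsub>M\<^esub> = \<zero>\<^bsub>M\<^esub>"
    and smult_l_distr:
      "\<lbrakk>r \<in> carrier R; s \<in> carrier R; x \<in> carrier M\<rbrakk> \<Longrightarrow>
        (r \<oplus>\<^bsub>R\<^esub> s) \<odot>\<^bsub>M\<^esub> x = r \<odot>\<^bsub>M\<^esub> x \<oplus>\<^bsub>M\<^esub> s \<odot>\<^bsub>M\<^esub> x"
    and smult_assoc:
      "\<lbrakk>r \<in> carrier R; s \<in> carrier R; x \<in> carrier M\<rbrakk> \<Longrightarrow>
        (r \<otimes>\<^bsub>R\<^esub> s) \<odot>\<^bsub>M\<^esub> x = r \<odot>\<^bsub>M\<^esub> (s \<odot>\<^bsub>M\<^esub> x)"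
    and smult_l_null:
      "x \<in> carrier M \<Longrightarrow> \<zero>\<^bsub>R\<^esub> \<odot>\<^bsub>M\<^esub> x = \<zero>\<^bsub>M\<^esub>"
    and smult_one:
      "x \<in> carrier M \<Longrightarrow> \<one>\<^bsub>R\<^esub> \<odot>\<^bsub>M\<^esub> x = x"

definition proper_semimodule :: "('a, 'c) ring_scheme \<Rightarrow> ('a, 'm, 'd) module_scheme \<Rightarrow> bool" where
  "proper_semimodule R M \<longleftrightarrow> semimodule R M \<and> \<not> abelian_group M"

definition subsemimodule ::
    "'m set \<Rightarrow> ('a, 'c) ring_scheme \<Rightarrow> ('a, 'm, 'd) module_scheme \<Rightarrow> bool" where
  "subsemimodule N R M \<longleftrightarrow>
     submonoid N (add_monoid M) \<and> (\<forall>r\<in>carrier R. \<forall>x\<in>N. r \<odot>\<^bsub>M\<^esub> x \<in> N)"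

definition minimal_semimodule :: "('a, 'c) ring_scheme \<Rightarrow> ('a, 'm, 'd) module_scheme \<Rightarrow> bool" where
  "minimal_semimodule R M \<longleftrightarrow>
     semimodule R M \<and> carrier M \<noteq> {\<zero>\<^bsub>M\<^esub>} \<and>
     (\<forall>N. subsemimodule N R M \<longrightarrow> N = {\<zero>\<^bsub>M\<^esub>} \<or> N = carrier M)"

definition semimodule_congruence ::
    "('a, 'c) ring_scheme \<Rightarrow> ('a, 'm, 'd) module_scheme \<Rightarrow> ('m \<times> 'm) set \<Rightarrow> bool" where
  "semimodule_congruence R M \<theta> \<longleftrightarrow>
     equiv (carrier M) \<theta> \<and>
     (\<forall>(m, n)\<in>\<theta>. (\<forall>k\<in>carrier M. (m \<oplus>\<^bsub>M\<^esub> k, n \<oplus>\<^bsub>M\<^esub> k) \<in> \<theta>) \<and>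
                (\<forall>r\<in>carrier R. (r \<odot>\<^bsub>M\<^esub> m, r \<odot>\<^bsub>M\<^esub> n) \<in> \<theta>))"

text \<open>Operations are lifted to classes by taking the union of the classes of the results over all
  representatives, as in \<^theory>\<open>HOL.Equiv_Relations\<close>; for a congruence this union is a single
  class.\<close>

definition quot_semimodule ::
    "('a, 'm, 'd) module_scheme \<Rightarrow> ('m \<times> 'm) set \<Rightarrow> ('a, 'm set) module" where
  "quot_semimodule M \<theta> =
     \<lparr>carrier = carrier M // \<theta>, mult = undefined, one = undefined,
      zero = \<theta> `` {\<zero>\<^bsub>M\<^esub>},
      add = (\<lambda>X Y. \<Union>x\<in>X. \<Union>y\<in>Y. \<theta> `` {x \<oplus>\<^bsub>M\<^esub> y}),
      smult = (\<lambda>r X. \<Union>x\<in>X. \<theta> `` {r \<odot>\<^bsub>M\<^esub> x})\<rparr>"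

definition semimodule_iso ::
    "('a, 'c) ring_scheme \<Rightarrow> ('a, 'm, 'd) module_scheme \<Rightarrow> ('a, 'n, 'e) module_scheme \<Rightarrow>
     ('m \<Rightarrow> 'n) set" where
  "semimodule_iso R M N =
     {f. bij_betw f (carrier M) (carrier N) \<and>
         f \<zero>\<^bsub>M\<^esub> = \<zero>\<^bsub>N\<^esub> \<and>
         (\<forall>x\<in>carrier M. \<forall>y\<in>carrier M. f (x \<oplus>\<^bsub>M\<^esub> y) = f x \<oplus>\<^bsub>N\<^esub> f y) \<and>
         (\<forall>r\<in>carrier R. \<forall>x\<in>carrier M. f (r \<odot>\<^bsub>M\<^esub> x) = r \<odot>\<^bsub>N\<^esub> f x)}"

section \<open>Finitely generated semirings over the natural numbers\<close>

text \<open>Coefficient families are taken in \<open>B \<rightarrow>\<^sub>E UNIV\<close>, so that uniqueness refers only to their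
  values on \<open>B\<close>.\<close>

locale fg_nat_semiring = semiring R for R (structure) +
  fixes B :: "'a set"
  assumes finite_basis: "finite B"
    and basis_subset: "B \<subseteq> carrier R"
    and basis: "x \<in> carrier R \<Longrightarrow>
      \<exists>!c. c \<in> B \<rightarrow>\<^sub>E (UNIV :: nat set) \<and> x = (\<Oplus>b\<in>B. [c b] \<cdot> b)"

definition basis_coeff :: "('a, 'c) ring_scheme \<Rightarrow> 'a set \<Rightarrow> 'a \<Rightarrow> 'a \<Rightarrow> nat" where
  "basis_coeff R B x =
     (THE c. c \<in> B \<rightarrow>\<^sub>E (UNIV :: nat set) \<and> x = (\<Oplus>\<^bsub>R\<^esub>b\<in>B. [c b] \<cdot>\<^bsub>R\<^esub> b))"

section \<open>Cells\<close>

definition left_le :: "('a, 'c) ring_scheme \<Rightarrow> 'a set \<Rightarrow> 'a \<Rightarrow> 'a \<Rightarrow> bool" where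
  "left_le R B a b \<longleftrightarrow> (\<exists>r\<in>carrier R. basis_coeff R B (r \<otimes>\<^bsub>R\<^esub> a) b \<noteq> 0)"

definition right_le :: "('a, 'c) ring_scheme \<Rightarrow> 'a set \<Rightarrow> 'a \<Rightarrow> 'a \<Rightarrow> bool" where
  "right_le R B a b \<longleftrightarrow> (\<exists>r\<in>carrier R. basis_coeff R B (a \<otimes>\<^bsub>R\<^esub> r) b \<noteq> 0)"

definition two_sided_le :: "('a, 'c) ring_scheme \<Rightarrow> 'a set \<Rightarrow> 'a \<Rightarrow> 'a \<Rightarrow> bool" where
  "two_sided_le R B a b \<longleftrightarrow>
     (\<exists>r\<in>carrier R. \<exists>s\<in>carrier R. basis_coeff R B (r \<otimes>\<^bsub>R\<^esub> a \<otimes>\<^bsub>R\<^esub> s) b \<noteq> 0)"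

definition preorder_classes :: "'a set \<Rightarrow> ('a \<Rightarrow> 'a \<Rightarrow> bool) \<Rightarrow> 'a set set" where
  "preorder_classes B P = B // {(a, b). a \<in> B \<and> b \<in> B \<and> P a b \<and> P b a}"

definition left_cells :: "('a, 'c) ring_scheme \<Rightarrow> 'a set \<Rightarrow> 'a set set" where
  "left_cells R B = preorder_classes B (left_le R B)"

definition right_cells :: "('a, 'c) ring_scheme \<Rightarrow> 'a set \<Rightarrow> 'a set set" where
  "right_cells R B = preorder_classes B (right_le R B)"

definition two_sided_cells :: "('a, 'c) ring_scheme \<Rightarrow> 'a set \<Rightarrow> 'a set set" where
  "two_sided_cells R B = preorder_classes B (two_sided_le R B)"

definition strongly_regular_cell :: "('a, 'c) ring_scheme \<Rightarrow> 'a set \<Rightarrow> 'a set \<Rightarrow> bool" where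
  "strongly_regular_cell R B J \<longleftrightarrow>
     (\<forall>L\<in>left_cells R B. \<forall>K\<in>right_cells R B. L \<subseteq> J \<and> K \<subseteq> J \<longrightarrow> is_singleton (L \<inter> K))"

definition idempotent_cell :: "('a, 'c) ring_scheme \<Rightarrow> 'a set \<Rightarrow> 'a set \<Rightarrow> bool" where
  "idempotent_cell R B J \<longleftrightarrow>
     (\<exists>x\<in>J. \<exists>y\<in>J. \<exists>z\<in>J. basis_coeff R B (x \<otimes>\<^bsub>R\<^esub> y) z \<noteq> 0)"

section \<open>Cell semimodules\<close>

definition supp_congruence :: "('a, 'c) ring_scheme \<Rightarrow> 'a set \<Rightarrow> ('a \<times> 'a) set" where
  "supp_congruence R B =
     {(x, y). x \<in> carrier R \<and> y \<in> carrier R \<and>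
        (\<forall>b\<in>B. basis_coeff R B x b \<noteq> 0 \<longleftrightarrow> basis_coeff R B y b \<noteq> 0)}"

definition quot_semiring :: "('a, 'c) ring_scheme \<Rightarrow> ('a \<times> 'a) set \<Rightarrow> 'a set ring" where
  "quot_semiring R \<rho> =
     \<lparr>carrier = carrier R // \<rho>,
      mult = (\<lambda>X Y. \<Union>x\<in>X. \<Union>y\<in>Y. \<rho> `` {x \<otimes>\<^bsub>R\<^esub> y}),
      one = \<rho> `` {\<one>\<^bsub>R\<^esub>}, zero = \<rho> `` {\<zero>\<^bsub>R\<^esub>},
      add = (\<lambda>X Y. \<Union>x\<in>X. \<Union>y\<in>Y. \<rho> `` {x \<oplus>\<^bsub>R\<^esub> y})\<rparr>"

definition boolean_quot :: "('a, 'c) ring_scheme \<Rightarrow> 'a set \<Rightarrow> 'a set ring" where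
  "boolean_quot R B = quot_semiring R (supp_congruence R B)"

definition boolean_class :: "('a, 'c) ring_scheme \<Rightarrow> 'a set \<Rightarrow> 'a \<Rightarrow> 'a set" where
  "boolean_class R B x = supp_congruence R B `` {x}"

text \<open>A class has Boolean coefficient 1 at a basis element if and only if one (equivalently, every)
  representative has a non-zero coefficient there, so its projection is the sum of the classes of
  the basis elements in \<open>L\<close> at which this happens.\<close>

definition cell_proj :: "('a, 'c) ring_scheme \<Rightarrow> 'a set \<Rightarrow> 'a set \<Rightarrow> 'a set \<Rightarrow> 'a set" where
  "cell_proj R B L X =
     (\<Oplus>\<^bsub>boolean_quot R B\<^esub>b\<in>{b \<in> L. \<exists>x\<in>X. basis_coeff R B x b \<noteq> 0}. boolean_class R B b)"

definition cell_semimodule ::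
    "('a, 'c) ring_scheme \<Rightarrow> 'a set \<Rightarrow> 'a set \<Rightarrow> ('a, 'a set) module" where
  "cell_semimodule R B L =
     \<lparr>carrier = \<Inter>{N. submonoid N (add_monoid (boolean_quot R B)) \<and> boolean_class R B ` L \<subseteq> N},
      mult = undefined, one = undefined,
      zero = \<zero>\<^bsub>boolean_quot R B\<^esub>,
      add = add (boolean_quot R B),
      smult = (\<lambda>r X. cell_proj R B L (boolean_class R B r \<otimes>\<^bsub>boolean_quot R B\<^esub> X))\<rparr>"

end

theory Submission
  imports Defs
begin

text \<open>
  The two halves rest on different facts.

  Let \<open>M\<close> be minimal and proper.  Minimality is used through well-chosen subsemimodules, each of
  which must be zero or everything.  The additively invertible elements are not everything, so
  \<open>M\<close> is zero-sum-free (\<open>zero_sum_free\<close>); hence every \<open>x\<close> is divisible by every positive integer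
  (\<open>divisible\<close>), and \<open>M = R x\<close> for \<open>x\<close> non-zero.  Dividing \<open>x\<close> by all integers produces infinitely
  many elements of \<open>R\<close> but only finitely many supports; comparing two of them with equal support
  gives \<open>x = x + x + z\<close> (\<open>absorbs_double\<close>), whence a non-zero additive idempotent, and therefore
  all of \<open>M\<close> is idempotent (\<open>add_idempotent\<close>).  The action of \<open>r\<close> on an idempotent semimodule
  depends only on the support of \<open>r\<close>.  Now choose a basis element \<open>a\<close>, maximal for the left order
  among those that do not annihilate \<open>M\<close>, and \<open>x\<^sub>0\<close> with \<open>a x\<^sub>0 \<noteq> 0\<close>.  Everything strictly above
  \<open>a\<close> kills \<open>M\<close>, so acting on \<open>x\<^sub>0\<close> is a homomorphism from the cell semimodule of the left cell
  of \<open>a\<close>, and it is onto because \<open>M = R (a x\<^sub>0)\<close>.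

  For the converse, let \<open>L\<close> be a left cell in the two-sided cell \<open>J\<close>.  The key point is that on
  \<open>J\<close> the left and right pre-orders are symmetric: \<open>a \<le>\<^sub>L b\<close> implies \<open>b \<le>\<^sub>L a\<close>.  For a product
  that records supports only this can fail, so the sizes of the structure constants matter.  Left
  multiplication by the sum \<open>s\<close> of the basis commutes on \<open>J\<close> with the strictly positive matrix
  \<open>x \<mapsto> s x s\<close>, and a non-negative matrix commuting with a positive one cannot have a closed set of
  indices with an edge entering it from outside (a Perron-Frobenius phenomenon, proved in
  \<open>closed_set_reflects_edges\<close> by counting).  Given this, idempotency of \<open>J\<close> yields for each
  \<open>b \<in> L\<close> some \<open>e \<in> J\<close> with \<open>e b\<close> non-zero in the cell semimodule, and strong regularity lets one
  move \<open>e\<close> inside its left cell to the right cell of any prescribed \<open>b' \<in> L\<close>.  Then \<open>e\<close> maps every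
  element of \<open>L\<close> to \<open>b'\<close> or to \<open>0\<close>, and \<open>b\<close> to \<open>b'\<close> (\<open>exists_matrix_unit\<close>).  So any non-zero
  element of the cell semimodule reaches every generator, and this passes to quotients.
\<close>

section \<open>Commuting matrices of natural numbers\<close>

definition mat_prod :: "'i set \<Rightarrow> ('i \<Rightarrow> 'i \<Rightarrow> nat) \<Rightarrow> ('i \<Rightarrow> 'i \<Rightarrow> nat) \<Rightarrow> 'i \<Rightarrow> 'i \<Rightarrow> nat" where
  "mat_prod J A C = (\<lambda>i j. \<Sum>k\<in>J. A i k * C k j)"

text \<open>The exponents are shifted by one, \<open>mat_pow J N n\<close> being the power \<open>n + 1\<close> of \<open>N\<close>, so that no
  identity matrix on \<open>J\<close> is needed.\<close>

primrec mat_pow :: "'i set \<Rightarrow> ('i \<Rightarrow> 'i \<Rightarrow> nat) \<Rightarrow> nat \<Rightarrow> 'i \<Rightarrow> 'i \<Rightarrow> nat" where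
  "mat_pow J N 0 = N"
| "mat_pow J N (Suc n) = mat_prod J (mat_pow J N n) N"

definition mat_total :: "'i set \<Rightarrow> ('i \<Rightarrow> 'i \<Rightarrow> nat) \<Rightarrow> nat" where
  "mat_total J A = (\<Sum>i\<in>J. \<Sum>j\<in>J. A i j)"

lemma mat_prod_assoc:
  "mat_prod J (mat_prod J A C) D = mat_prod J A (mat_prod J C D)"
proof (intro ext)
  fix i j
  have "mat_prod J (mat_prod J A C) D i j = (\<Sum>k\<in>J. \<Sum>l\<in>J. A i l * C l k * D k j)"
    by (simp add: mat_prod_def sum_distrib_right)
  also have "\<dots> = (\<Sum>l\<in>J. \<Sum>k\<in>J. A i l * C l k * D k j)"
    by (rule sum.swap)
  also have "\<dots> = mat_prod J A (mat_prod J C D) i j"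
    by (simp add: mat_prod_def sum_distrib_left mult.assoc)
  finally show "mat_prod J (mat_prod J A C) D i j = mat_prod J A (mat_prod J C D) i j" .
qed

lemma mat_prod_cong:
  assumes "\<And>k. k \<in> J \<Longrightarrow> A i k = A' i k" "\<And>k. k \<in> J \<Longrightarrow> C k j = C' k j"
  shows "mat_prod J A C i j = mat_prod J A' C' i j"
  using assms by (simp add: mat_prod_def)

lemma mat_pow_add:
  "mat_prod J (mat_pow J N m) (mat_pow J N n) = mat_pow J N (Suc (m + n))"
  by (induction n) (simp_all add: mat_prod_assoc[symmetric])

lemma entry_le_mat_total:
  assumes "finite J" "i \<in> J" "j \<in> J"
  shows "A i j \<le> mat_total J A"
proof -
  have "A i j \<le> (\<Sum>j\<in>J. A i j)" using assms by (intro member_le_sum) auto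
  also have "\<dots> \<le> mat_total J A"
    unfolding mat_total_def using assms by (intro member_le_sum[where f = "\<lambda>i. \<Sum>j\<in>J. A i j"]) auto
  finally show ?thesis .
qed

lemma mat_total_prod_le:
  assumes "finite J"
  shows "mat_total J (mat_prod J A C) \<le> mat_total J A * mat_total J C"
proof -
  have "mat_total J (mat_prod J A C) = (\<Sum>i\<in>J. \<Sum>j\<in>J. \<Sum>k\<in>J. A i k * C k j)"
    by (simp add: mat_total_def mat_prod_def)
  also have "\<dots> = (\<Sum>i\<in>J. \<Sum>k\<in>J. A i k * (\<Sum>j\<in>J. C k j))"
    by (simp add: sum_distrib_left) (intro sum.cong refl sum.swap)
  also have "\<dots> \<le> (\<Sum>i\<in>J. \<Sum>k\<in>J. A i k * mat_total J C)"
    unfolding mat_total_def using assms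
    by (intro sum_mono mult_left_mono member_le_sum[where f = "\<lambda>i. \<Sum>j\<in>J. C i j"]) auto
  also have "\<dots> = mat_total J A * mat_total J C"
    by (simp add: mat_total_def sum_distrib_right)
  finally show ?thesis .
qed

lemma mat_total_le_sandwich:
  assumes "finite J" "\<And>i j. i \<in> J \<Longrightarrow> j \<in> J \<Longrightarrow> 1 \<le> T i j" "i \<in> J" "j \<in> J"
  shows "mat_total J A \<le> mat_prod J T (mat_prod J A T) i j"
proof -
  have "mat_total J A \<le> (\<Sum>k\<in>J. T i k * (\<Sum>l\<in>J. A k l * T l j))"
    unfolding mat_total_def
  proof (rule sum_mono)
    fix k assume k: "k \<in> J"
    have "(\<Sum>l\<in>J. A k l) \<le> (\<Sum>l\<in>J. A k l * T l j)"
      using assms by (intro sum_mono) simp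
    also have "\<dots> \<le> T i k * (\<Sum>l\<in>J. A k l * T l j)"
      using assms(2)[OF assms(3) k] by (cases "T i k") auto
    finally show "(\<Sum>l\<in>J. A k l) \<le> T i k * (\<Sum>l\<in>J. A k l * T l j)" .
  qed
  then show ?thesis by (simp add: mat_prod_def)
qed

text \<open>Read \<open>N i j \<noteq> 0\<close> as an edge from \<open>j\<close> to \<open>i\<close>.  With \<open>X n = T * N^(n+1) * T\<close>, where \<open>T\<close> is positive,
  all entries of \<open>X n\<close> agree with the total mass \<open>M n\<close> of \<open>N^(n+1)\<close> up to a constant factor.  The
  partial pairing \<open>F m n\<close> of row \<open>a\<close> of \<open>X m\<close> with column \<open>a\<close> of \<open>X n\<close> over the closed set \<open>S\<close>
  changes, when a factor \<open>N\<close> is moved from right to left, exactly by the mass \<open>E m n\<close> flowing into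
  \<open>S\<close> from outside.  If an edge entered \<open>S\<close> from \<open>a\<close>, each of \<open>n\<close> moves would contribute at least
  \<open>M n\<close> by submultiplicativity, so that \<open>n * M n \<le> F 0 n\<close>, while \<open>F 0 n\<close> is at most a constant times
  \<open>M n\<close>.\<close>

lemma closed_set_reflects_edges:
  assumes fin: "finite J" and "S \<subseteq> J"
    and comm: "\<And>i j. i \<in> J \<Longrightarrow> j \<in> J \<Longrightarrow> mat_prod J N T i j = mat_prod J T N i j"
    and T: "\<And>i j. i \<in> J \<Longrightarrow> j \<in> J \<Longrightarrow> 1 \<le> T i j"
    and diag: "\<And>i. i \<in> J \<Longrightarrow> 1 \<le> N i i"
    and closed: "\<And>i j. i \<in> J \<Longrightarrow> j \<in> S \<Longrightarrow> N i j \<noteq> 0 \<Longrightarrow> i \<in> S"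
    and b: "b \<in> S" and a: "a \<in> J" and edge: "N b a \<noteq> 0"
  shows "a \<in> S"
proof (rule ccontr)
  assume aS: "a \<notin> S"
  define Q where "Q = mat_pow J N"
  define X where "X n = mat_prod J T (mat_prod J (Q n) T)" for n
  define M where "M n = mat_total J (Q n)" for n
  define F where "F m n = (\<Sum>k\<in>S. X m a k * X n k a)" for m n
  define E where "E m n = (\<Sum>k\<in>S. \<Sum>l\<in>J - S. X m a k * N k l * X n l a)" for m n
  note finS = finite_subset[OF \<open>S \<subseteq> J\<close> fin]
  have bJ: "b \<in> J" using b \<open>S \<subseteq> J\<close> by auto

  have lower: "M n \<le> X n i j" if "i \<in> J" "j \<in> J" for n i j
    unfolding M_def X_def using fin T that by (intro mat_total_le_sandwich) auto
  have upper: "X n i j \<le> mat_total J T * (M n * mat_total J T)" if "i \<in> J" "j \<in> J" for n i j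
  proof -
    have "X n i j \<le> mat_total J (X n)" using fin that by (intro entry_le_mat_total)
    also have "\<dots> \<le> mat_total J T * mat_total J (mat_prod J (Q n) T)"
      unfolding X_def using fin by (rule mat_total_prod_le)
    also have "\<dots> \<le> mat_total J T * (M n * mat_total J T)"
      unfolding M_def using fin by (intro mult_left_mono mat_total_prod_le) auto
    finally show ?thesis .
  qed
  have submult: "M (Suc (m + n)) \<le> M m * M n" for m n
    unfolding M_def Q_def mat_pow_add[symmetric] using fin by (rule mat_total_prod_le)
  have diag_pow: "1 \<le> Q n i i" if "i \<in> J" for n i
  proof (induction n)
    case (Suc n)
    have "1 \<le> Q n i i * N i i" using Suc diag[OF that] by simp
    also have "\<dots> \<le> (\<Sum>k\<in>J. Q n i k * N k i)"
      using fin that by (intro member_le_sum[where f = "\<lambda>k. Q n i k * N k i"]) auto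
    finally show ?case by (simp add: Q_def mat_prod_def)
  qed (use diag that in \<open>simp add: Q_def\<close>)
  have pos: "1 \<le> M n" for n
    unfolding M_def using diag_pow[OF a, of n] entry_le_mat_total[OF fin a a, of "Q n"] by linarith

  have right: "X (Suc m) a k = (\<Sum>l\<in>J. X m a l * N l k)" if "k \<in> J" for m k
  proof -
    have "(\<Sum>l\<in>J. X m a l * N l k) = mat_prod J (mat_prod J T (Q m)) (mat_prod J T N) a k"
      by (simp add: X_def mat_prod_assoc[symmetric]) (simp add: mat_prod_def)
    also have "\<dots> = mat_prod J (mat_prod J T (Q m)) (mat_prod J N T) a k"
      by (rule mat_prod_cong) (use comm that in auto)
    also have "\<dots> = X (Suc m) a k" by (simp add: X_def mat_prod_assoc Q_def)
    finally show ?thesis by simp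
  qed
  have left: "X (Suc n) k a = (\<Sum>l\<in>J. N k l * X n l a)" if "k \<in> J" for n k
  proof -
    have "(\<Sum>l\<in>J. N k l * X n l a) = mat_prod J (mat_prod J N T) (mat_prod J (Q n) T) k a"
      by (simp add: X_def mat_prod_assoc) (simp add: mat_prod_def)
    also have "\<dots> = mat_prod J (mat_prod J T N) (mat_prod J (Q n) T) k a"
      by (rule mat_prod_cong) (use comm that in auto)
    also have "\<dots> = mat_prod J T (mat_prod J (mat_prod J N (Q n)) T) k a"
      by (simp add: mat_prod_assoc)
    also have "mat_prod J N (Q n) = Q (Suc n)"
      using mat_pow_add[of J N 0 n] by (simp add: Q_def)
    finally show ?thesis by (simp add: X_def)
  qed

  have F_step: "F m (Suc n) = F (Suc m) n + E m n" for m n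
  proof -
    have "F m (Suc n) = (\<Sum>k\<in>S. \<Sum>l\<in>J. X m a k * N k l * X n l a)"
      unfolding F_def using \<open>S \<subseteq> J\<close>
      by (intro sum.cong refl) (auto simp: left sum_distrib_left mult.assoc)
    also have "\<dots> = (\<Sum>k\<in>S. (\<Sum>l\<in>S. X m a k * N k l * X n l a) + (\<Sum>l\<in>J - S. X m a k * N k l * X n l a))"
      using fin \<open>S \<subseteq> J\<close> by (intro sum.cong refl) (simp add: sum.subset_diff)
    also have "\<dots> = (\<Sum>k\<in>S. \<Sum>l\<in>S. X m a k * N k l * X n l a) + E m n"
      by (simp add: E_def sum.distrib)
    also have "(\<Sum>k\<in>S. \<Sum>l\<in>S. X m a k * N k l * X n l a) = (\<Sum>l\<in>S. \<Sum>k\<in>S. X m a k * N k l * X n l a)"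
      by (rule sum.swap)
    also have "\<dots> = (\<Sum>l\<in>S. \<Sum>k\<in>J. X m a k * N k l * X n l a)"
    proof (rule sum.cong[OF refl], rule sum.mono_neutral_left, safe)
      fix l k assume "l \<in> S" "k \<in> J" "k \<notin> S"
      then have "N k l = 0" using closed[of k l] by blast
      then show "X m a k * N k l * X n l a = 0" by simp
    qed (use fin \<open>S \<subseteq> J\<close> in auto)
    also have "\<dots> = F (Suc m) n"
      unfolding F_def using \<open>S \<subseteq> J\<close>
      by (intro sum.cong refl) (auto simp: right sum_distrib_right)
    finally show ?thesis .
  qed
  have E_ge: "M (Suc (m + n)) \<le> E m n" for m n
  proof -
    have "M (Suc (m + n)) \<le> M m * M n" by (rule submult)
    also have "\<dots> \<le> X m a b * X n a a"
      using lower a bJ by (intro mult_mono) auto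
    also have "\<dots> \<le> X m a b * N b a * X n a a" using edge by simp
    also have "\<dots> \<le> (\<Sum>l\<in>J - S. X m a b * N b l * X n l a)"
      using fin a aS by (intro member_le_sum[where f = "\<lambda>l. X m a b * N b l * X n l a"]) auto
    also have "\<dots> \<le> E m n"
      unfolding E_def using finS b
      by (intro member_le_sum[where f = "\<lambda>k. \<Sum>l\<in>J - S. X m a k * N k l * X n l a"]) auto
    finally show ?thesis .
  qed
  have growth: "n * M (m + n) \<le> F m n" for m n
  proof (induction n arbitrary: m)
    case (Suc n)
    have "Suc n * M (m + Suc n) = n * M (Suc m + n) + M (Suc (m + n))" by simp
    also have "\<dots> \<le> F (Suc m) n + E m n" using Suc E_ge by (intro add_mono)
    finally show ?case by (simp add: F_step)
  qed simp
  define K where "K = (\<Sum>k\<in>S. X 0 a k * (mat_total J T * mat_total J T))"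
  have bounded: "F 0 n \<le> K * M n" for n
  proof -
    have "F 0 n \<le> (\<Sum>k\<in>S. X 0 a k * (mat_total J T * (M n * mat_total J T)))"
      unfolding F_def using upper a \<open>S \<subseteq> J\<close> by (intro sum_mono mult_left_mono) auto
    then show ?thesis by (simp add: K_def sum_distrib_left sum_distrib_right mult_ac)
  qed
  have "Suc K * M (Suc K) \<le> K * M (Suc K)"
    using growth[of "Suc K" 0] bounded[of "Suc K"] by simp
  then show False using pos[of "Suc K"] by simp
qed

section \<open>Coefficients and supports\<close>

context fg_nat_semiring begin

abbreviation coeff :: "'a \<Rightarrow> 'a \<Rightarrow> nat" where
  "coeff \<equiv> basis_coeff R B"

lemma finite_subset_basis: "S \<subseteq> B \<Longrightarrow> finite S"
  using finite_basis finite_subset by blast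

lemma basis_carrier [simp]: "b \<in> B \<Longrightarrow> b \<in> carrier R"
  using basis_subset by blast

lemma basis_expansion:
  assumes "x \<in> carrier R"
  shows "x = (\<Oplus>b\<in>B. [coeff x b] \<cdot> b)"
  using theI'[OF basis[OF assms]] unfolding basis_coeff_def by blast

lemma coeff_unique:
  assumes "b \<in> B" "x \<in> carrier R" "x = (\<Oplus>b\<in>B. [(c b :: nat)] \<cdot> b)"
  shows "coeff x b = c b"
proof -
  have "x = (\<Oplus>b\<in>B. [restrict c B b] \<cdot> b)"
    unfolding assms(3) by (intro finsum_cong') auto
  then have "basis_coeff R B x = restrict c B"
    unfolding basis_coeff_def by (intro the1_equality[OF basis[OF assms(2)]]) auto
  then show ?thesis using assms(1) by simp
qed

lemma coeff_add:
  assumes "b \<in> B" "x \<in> carrier R" "y \<in> carrier R"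
  shows "coeff (x \<oplus> y) b = coeff x b + coeff y b"
proof (rule coeff_unique)
  have "x \<oplus> y = (\<Oplus>b\<in>B. [coeff x b] \<cdot> b) \<oplus> (\<Oplus>b\<in>B. [coeff y b] \<cdot> b)"
    using basis_expansion assms by metis
  also have "\<dots> = (\<Oplus>b\<in>B. [coeff x b] \<cdot> b \<oplus> [coeff y b] \<cdot> b)"
    by (rule finsum_addf[symmetric]) auto
  also have "\<dots> = (\<Oplus>b\<in>B. [(coeff x b + coeff y b)] \<cdot> b)"
    by (intro finsum_cong') (auto simp: add.nat_pow_mult)
  finally show "x \<oplus> y = (\<Oplus>b\<in>B. [(coeff x b + coeff y b)] \<cdot> b)" .
qed (use assms in auto)

lemma coeff_zero: "b \<in> B \<Longrightarrow> coeff \<zero> b = 0"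
  using coeff_add[of b \<zero> \<zero>] by simp

lemma coeff_basis:
  assumes "a \<in> B" "b \<in> B"
  shows "coeff a b = (if b = a then 1 else 0)"
proof (rule coeff_unique)
  have "(\<Oplus>b\<in>B. [(if b = a then 1 else 0 :: nat)] \<cdot> b) = (\<Oplus>b\<in>B. if a = b then b else \<zero>)"
    by (intro finsum_cong') auto
  also have "\<dots> = a" using assms finite_basis by (intro add.finprod_singleton) auto
  finally show "a = (\<Oplus>b\<in>B. [(if b = a then 1 else 0 :: nat)] \<cdot> b)" by simp
qed (use assms in auto)

lemma coeff_finsum:
  assumes "finite I" "f \<in> I \<rightarrow> carrier R" "b \<in> B"
  shows "coeff (\<Oplus>i\<in>I. f i) b = (\<Sum>i\<in>I. coeff (f i) b)"
  using assms by (induction I) (auto simp: coeff_zero coeff_add Pi_def)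

lemma coeff_add_pow:
  assumes "x \<in> carrier R" "b \<in> B"
  shows "coeff ([(n :: nat)] \<cdot> x) b = n * coeff x b"
  using assms by (induction n) (auto simp: coeff_zero coeff_add)

text \<open>Two-sided multiplications are matrices acting on coefficient vectors; both one-sided ones are
  special cases, which later treats the left and the right pre-order at once.\<close>

lemma coeff_mult_mult:
  assumes "u \<in> carrier R" "v \<in> carrier R" "x \<in> carrier R" "b \<in> B"
  shows "coeff (u \<otimes> x \<otimes> v) b = (\<Sum>k\<in>B. coeff (u \<otimes> k \<otimes> v) b * coeff x k)"
proof -
  have "u \<otimes> x \<otimes> v = u \<otimes> (\<Oplus>k\<in>B. [coeff x k] \<cdot> k) \<otimes> v"
    using basis_expansion[OF assms(3)] by simp
  also have "\<dots> = (\<Oplus>k\<in>B. u \<otimes> [coeff x k] \<cdot> k \<otimes> v)"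
    using assms finite_basis by (simp add: finsum_ldistr finsum_rdistr Pi_def)
  also have "coeff \<dots> b = (\<Sum>k\<in>B. coeff (u \<otimes> [coeff x k] \<cdot> k \<otimes> v) b)"
    using assms finite_basis by (intro coeff_finsum) auto
  also have "\<dots> = (\<Sum>k\<in>B. coeff (u \<otimes> k \<otimes> v) b * coeff x k)"
    using assms by (intro sum.cong refl)
      (simp add: add_pow_ldistr add_pow_rdistr coeff_add_pow)
  finally show ?thesis .
qed

definition supp :: "'a \<Rightarrow> 'a set" where
  "supp x = {b \<in> B. coeff x b \<noteq> 0}"

lemma supp_subset: "supp x \<subseteq> B"
  by (auto simp: supp_def)

lemma supp_add: "x \<in> carrier R \<Longrightarrow> y \<in> carrier R \<Longrightarrow> supp (x \<oplus> y) = supp x \<union> supp y"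
  by (auto simp: supp_def coeff_add)

lemma supp_zero: "supp \<zero> = {}"
  by (auto simp: supp_def coeff_zero)

lemma supp_basis: "b \<in> B \<Longrightarrow> supp b = {b}"
  by (auto simp: supp_def coeff_basis split: if_splits)

lemma supp_mult_mult:
  assumes "u \<in> carrier R" "v \<in> carrier R" "x \<in> carrier R"
  shows "supp (u \<otimes> x \<otimes> v) = (\<Union>k\<in>supp x. supp (u \<otimes> k \<otimes> v))"
proof -
  have "coeff (u \<otimes> x \<otimes> v) b \<noteq> 0 \<longleftrightarrow> (\<exists>k\<in>B. coeff (u \<otimes> k \<otimes> v) b \<noteq> 0 \<and> coeff x k \<noteq> 0)"
    if "b \<in> B" for b
    using finite_basis by (subst coeff_mult_mult[OF assms that], subst sum_eq_0_iff) auto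
  then show ?thesis by (auto simp: supp_def)
qed

lemma supp_mult_right:
  assumes "u \<in> carrier R" "x \<in> carrier R"
  shows "supp (u \<otimes> x) = (\<Union>k\<in>supp x. supp (u \<otimes> k))"
  using supp_mult_mult[of u \<one> x] assms supp_subset[of x] by (auto simp: subset_iff)

lemma supp_mult_left:
  assumes "u \<in> carrier R" "x \<in> carrier R"
  shows "supp (x \<otimes> u) = (\<Union>k\<in>supp x. supp (k \<otimes> u))"
  using supp_mult_mult[of \<one> u x] assms supp_subset[of x] by (auto simp: subset_iff)

definition sum_of :: "'a set \<Rightarrow> 'a" where
  "sum_of S = (\<Oplus>b\<in>S. b)"

lemma sum_of_carrier [simp]: "S \<subseteq> B \<Longrightarrow> sum_of S \<in> carrier R"
  unfolding sum_of_def by (intro finsum_closed) auto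

lemma supp_sum_of: "S \<subseteq> B \<Longrightarrow> supp (sum_of S) = S"
proof (induction S rule: infinite_finite_induct)
  case (insert b S)
  have "sum_of (insert b S) = b \<oplus> sum_of S"
    unfolding sum_of_def using insert by (intro finsum_insert) auto
  then show ?case using insert by (simp add: supp_add supp_basis)
qed (auto simp: sum_of_def supp_zero dest: finite_subset_basis)

lemma supp_induct [consumes 1, case_names zero basis add]:
  assumes "x \<in> carrier R"
    and zero: "P \<zero>"
    and basis: "\<And>b. b \<in> supp x \<Longrightarrow> P b"
    and add: "\<And>u v. u \<in> carrier R \<Longrightarrow> v \<in> carrier R \<Longrightarrow> P u \<Longrightarrow> P v \<Longrightarrow> P (u \<oplus> v)"
  shows "P x"
proof -
  have pow: "P ([coeff x b] \<cdot> b)" if "b \<in> B" for b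
  proof (cases "coeff x b = 0")
    case False
    then have "P b" using that by (intro basis) (simp add: supp_def)
    have "P ([n] \<cdot> b)" for n :: nat
      using \<open>P b\<close> that by (induction n) (auto intro: zero add)
    then show ?thesis .
  qed (simp add: zero)
  have "P (\<Oplus>b\<in>S. [coeff x b] \<cdot> b)" if "finite S" "S \<subseteq> B" for S
    using that
  proof (induction S)
    case (insert b S)
    then have "(\<Oplus>b\<in>insert b S. [coeff x b] \<cdot> b) = [coeff x b] \<cdot> b \<oplus> (\<Oplus>b\<in>S. [coeff x b] \<cdot> b)"
      by (intro finsum_insert) auto
    then show ?case using insert by (auto intro!: add pow finsum_closed)
  qed (simp add: zero)
  from this[OF finite_basis] show ?thesis using basis_expansion[OF assms(1)] by simp
qed

text \<open>A bound that depends on \<open>x\<close> only: \<open>n\<close> can be fixed before \<open>y\<close> is chosen, because every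
  coefficient of \<open>y\<close> on the support of \<open>x\<close> is at least one.\<close>

lemma multiple_dominates:
  assumes "x \<in> carrier R"
  obtains n :: nat where
    "\<And>y. y \<in> carrier R \<Longrightarrow> supp x \<subseteq> supp y \<Longrightarrow> \<exists>z\<in>carrier R. [n] \<cdot> y = x \<oplus> z"
proof
  fix y assume y: "y \<in> carrier R" "supp x \<subseteq> supp y"
  define n where "n = (\<Sum>b\<in>B. coeff x b)"
  define d where "d b = n * coeff y b - coeff x b" for b
  define z where "z = (\<Oplus>b\<in>B. [d b] \<cdot> b)"
  have z: "z \<in> carrier R" unfolding z_def by (intro finsum_closed) auto
  have le: "coeff x b \<le> n * coeff y b" if "b \<in> B" for b
  proof (cases "coeff x b = 0")
    case False
    then have "coeff y b \<noteq> 0" using that y by (auto simp: supp_def)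
    moreover have "coeff x b \<le> n"
      unfolding n_def using that finite_basis by (intro member_le_sum) auto
    ultimately show ?thesis by (cases "coeff y b") auto
  qed simp
  have "x \<oplus> z = (\<Oplus>b\<in>B. [coeff x b] \<cdot> b \<oplus> [d b] \<cdot> b)"
    unfolding z_def by (subst basis_expansion[OF assms], intro finsum_addf[symmetric]) auto
  also have "\<dots> = (\<Oplus>b\<in>B. [(n * coeff y b)] \<cdot> b)"
    by (intro finsum_cong') (auto simp: add.nat_pow_mult d_def le)
  also have "\<dots> = (\<Oplus>b\<in>B. [(coeff ([n] \<cdot> y) b)] \<cdot> b)"
    using y by (intro finsum_cong') (auto simp: coeff_add_pow)
  also have "\<dots> = [n] \<cdot> y" using y by (intro basis_expansion[symmetric]) auto
  finally show "\<exists>z\<in>carrier R. [(\<Sum>b\<in>B. coeff x b)] \<cdot> y = x \<oplus> z" using z unfolding n_def by metis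
qed

section \<open>One-sided orders inside a two-sided cell\<close>

lemma left_le_iff_supp: "b \<in> B \<Longrightarrow> left_le R B a b \<longleftrightarrow> (\<exists>r\<in>carrier R. b \<in> supp (r \<otimes> a))"
  by (simp add: left_le_def supp_def)

lemma right_le_iff_supp: "b \<in> B \<Longrightarrow> right_le R B a b \<longleftrightarrow> (\<exists>r\<in>carrier R. b \<in> supp (a \<otimes> r))"
  by (simp add: right_le_def supp_def)

lemma two_sided_le_iff_supp:
  "b \<in> B \<Longrightarrow> two_sided_le R B a b \<longleftrightarrow> (\<exists>r\<in>carrier R. \<exists>s\<in>carrier R. b \<in> supp (r \<otimes> a \<otimes> s))"
  by (simp add: two_sided_le_def supp_def)

lemma left_le_refl: "a \<in> B \<Longrightarrow> left_le R B a a"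
  by (auto simp: left_le_iff_supp supp_basis intro!: bexI[of _ \<one>])

lemma right_le_refl: "a \<in> B \<Longrightarrow> right_le R B a a"
  by (auto simp: right_le_iff_supp supp_basis intro!: bexI[of _ \<one>])

lemma left_le_trans:
  assumes "a \<in> B" "b \<in> B" "c \<in> B" "left_le R B a b" "left_le R B b c"
  shows "left_le R B a c"
proof -
  obtain r s where rs: "r \<in> carrier R" "s \<in> carrier R" "b \<in> supp (r \<otimes> a)" "c \<in> supp (s \<otimes> b)"
    using assms by (auto simp: left_le_iff_supp)
  then have "c \<in> supp (s \<otimes> (r \<otimes> a))"
    using assms by (subst supp_mult_right) auto
  then have "c \<in> supp (s \<otimes> r \<otimes> a)" using rs assms by (simp add: m_assoc)
  then show ?thesis using rs assms by (auto simp: left_le_iff_supp)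
qed

lemma right_le_trans:
  assumes "a \<in> B" "b \<in> B" "c \<in> B" "right_le R B a b" "right_le R B b c"
  shows "right_le R B a c"
proof -
  obtain r s where rs: "r \<in> carrier R" "s \<in> carrier R" "b \<in> supp (a \<otimes> r)" "c \<in> supp (b \<otimes> s)"
    using assms by (auto simp: right_le_iff_supp)
  then have "c \<in> supp (a \<otimes> r \<otimes> s)"
    using assms by (subst supp_mult_left) auto
  then have "c \<in> supp (a \<otimes> (r \<otimes> s))" using rs assms by (simp add: m_assoc)
  then show ?thesis using rs assms by (auto simp: right_le_iff_supp)
qed

lemma two_sided_le_trans:
  assumes "a \<in> B" "b \<in> B" "c \<in> B" "two_sided_le R B a b" "two_sided_le R B b c"
  shows "two_sided_le R B a c"
proof -
  obtain r s r' s' where rs: "r \<in> carrier R" "s \<in> carrier R" "b \<in> supp (r \<otimes> a \<otimes> s)"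
    "r' \<in> carrier R" "s' \<in> carrier R" "c \<in> supp (r' \<otimes> b \<otimes> s')"
    using assms by (auto simp: two_sided_le_iff_supp)
  then have "c \<in> supp (r' \<otimes> (r \<otimes> a \<otimes> s) \<otimes> s')"
    using assms by (subst supp_mult_mult) auto
  then have "c \<in> supp ((r' \<otimes> r) \<otimes> a \<otimes> (s \<otimes> s'))" using rs assms by (simp add: m_assoc)
  then show ?thesis using rs assms by (auto simp: two_sided_le_iff_supp)
qed

lemma left_le_imp_two_sided_le:
  "a \<in> B \<Longrightarrow> b \<in> B \<Longrightarrow> left_le R B a b \<Longrightarrow> two_sided_le R B a b"
  by (simp add: left_le_iff_supp two_sided_le_iff_supp) (metis basis_carrier m_closed one_closed r_one)

lemma right_le_imp_two_sided_le:
  "a \<in> B \<Longrightarrow> b \<in> B \<Longrightarrow> right_le R B a b \<Longrightarrow> two_sided_le R B a b"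
  by (simp add: right_le_iff_supp two_sided_le_iff_supp) (metis basis_carrier l_one one_closed)

lemma two_sided_le_refl: "a \<in> B \<Longrightarrow> two_sided_le R B a a"
  by (simp add: left_le_refl left_le_imp_two_sided_le)

text \<open>Multiplication by an element of full support reaches everything that any multiplication reaches,
  so a single matrix describes each of the pre-orders.\<close>

definition full :: 'a where
  "full = sum_of B"

lemma full_carrier [simp]: "full \<in> carrier R"
  by (simp add: full_def)

lemma supp_full: "supp full = B"
  by (simp add: full_def supp_sum_of)

lemma supp_mult_le_full_left:
  assumes "r \<in> carrier R" "x \<in> carrier R"
  shows "supp (r \<otimes> x) \<subseteq> supp (full \<otimes> x)"
  using assms supp_subset[of r]
  by (auto simp: supp_mult_left[of x r] supp_mult_left[of x full] supp_full)

lemma supp_mult_le_full_right: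
  assumes "r \<in> carrier R" "x \<in> carrier R"
  shows "supp (x \<otimes> r) \<subseteq> supp (x \<otimes> full)"
  using assms supp_subset[of r]
  by (auto simp: supp_mult_right[of x r] supp_mult_right[of x full] supp_full)

lemma left_le_iff_full:
  assumes "a \<in> B" "b \<in> B"
  shows "left_le R B a b \<longleftrightarrow> b \<in> supp (full \<otimes> a)"
  using assms supp_mult_le_full_left[of _ a] by (auto simp: left_le_iff_supp)

lemma right_le_iff_full:
  assumes "a \<in> B" "b \<in> B"
  shows "right_le R B a b \<longleftrightarrow> b \<in> supp (a \<otimes> full)"
  using assms supp_mult_le_full_right[of _ a] by (auto simp: right_le_iff_supp)

lemma two_sided_le_iff_full:
  assumes "a \<in> B" "b \<in> B"
  shows "two_sided_le R B a b \<longleftrightarrow> b \<in> supp (full \<otimes> a \<otimes> full)"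
proof
  assume "two_sided_le R B a b"
  then obtain r s where rs: "r \<in> carrier R" "s \<in> carrier R" "b \<in> supp (r \<otimes> a \<otimes> s)"
    using assms by (auto simp: two_sided_le_iff_supp)
  then have "b \<in> supp (r \<otimes> a \<otimes> full)"
    using assms supp_mult_le_full_right[of s "r \<otimes> a"] by auto
  then show "b \<in> supp (full \<otimes> a \<otimes> full)"
    using assms rs supp_mult_le_full_left[of r "a \<otimes> full"] by (auto simp: m_assoc)
qed (use assms full_carrier in \<open>unfold two_sided_le_iff_supp, blast\<close>)

text \<open>Composing multiplications corresponds to multiplying matrices even after restriction to a two-sided
  cell: an intermediate basis element on the way from the cell to the cell is again in the cell.\<close>

lemma mat_prod_coeff:
  assumes J: "J = {c \<in> B. two_sided_le R B a c \<and> two_sided_le R B c a}"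
    and "a \<in> B" "i \<in> J" "j \<in> J"
    and uv: "u \<in> carrier R" "v \<in> carrier R" "u' \<in> carrier R" "v' \<in> carrier R"
  shows "mat_prod J (\<lambda>i j. coeff (u \<otimes> j \<otimes> v) i) (\<lambda>i j. coeff (u' \<otimes> j \<otimes> v') i) i j
    = coeff ((u \<otimes> u') \<otimes> j \<otimes> (v' \<otimes> v)) i"
proof -
  have B: "i \<in> B" "j \<in> B" using assms by auto
  have "coeff (u \<otimes> k \<otimes> v) i * coeff (u' \<otimes> j \<otimes> v') k = 0" if "k \<in> B - J" for k
  proof (rule ccontr)
    assume "coeff (u \<otimes> k \<otimes> v) i * coeff (u' \<otimes> j \<otimes> v') k \<noteq> 0"
    then have "two_sided_le R B k i" "two_sided_le R B j k"
      using uv by (auto simp: two_sided_le_def)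
    then have "k \<in> J" using that \<open>a \<in> B\<close> \<open>i \<in> J\<close> \<open>j \<in> J\<close> two_sided_le_trans unfolding J by blast
    then show False using that by simp
  qed
  then have "mat_prod J (\<lambda>i j. coeff (u \<otimes> j \<otimes> v) i) (\<lambda>i j. coeff (u' \<otimes> j \<otimes> v') i) i j
    = (\<Sum>k\<in>B. coeff (u \<otimes> k \<otimes> v) i * coeff (u' \<otimes> j \<otimes> v') k)"
    unfolding mat_prod_def using finite_basis J by (intro sum.mono_neutral_left) auto
  also have "\<dots> = coeff (u \<otimes> (u' \<otimes> j \<otimes> v') \<otimes> v) i"
    using uv B by (intro coeff_mult_mult[symmetric]) auto
  finally show ?thesis using uv B by (simp add: m_assoc)
qed

text \<open>The left and the right pre-order are treated together: \<open>(u, v)\<close> is \<open>(full, \<one>)\<close> for the former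
  and \<open>(\<one>, full)\<close> for the latter.  The closed set of indices is the part of the two-sided cell
  above \<open>b\<close>; an edge leads into it from \<open>a\<close>, hence \<open>a\<close> is above \<open>b\<close>.\<close>

lemma one_sided_order_symmetric:
  assumes u: "u \<in> carrier R" "u \<otimes> full = full \<otimes> u"
    and v: "v \<in> carrier R" "v \<otimes> full = full \<otimes> v"
    and refl: "\<And>x. x \<in> B \<Longrightarrow> x \<in> supp (u \<otimes> x \<otimes> v)"
    and trans: "\<And>x y z. x \<in> B \<Longrightarrow> y \<in> supp (u \<otimes> x \<otimes> v) \<Longrightarrow> z \<in> supp (u \<otimes> y \<otimes> v) \<Longrightarrow>
      z \<in> supp (u \<otimes> x \<otimes> v)"
    and a: "a \<in> B" and b: "b \<in> supp (u \<otimes> a \<otimes> v)" and ba: "two_sided_le R B b a"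
  shows "a \<in> supp (u \<otimes> b \<otimes> v)"
proof -
  define J where "J = {c \<in> B. two_sided_le R B a c \<and> two_sided_le R B c a}"
  define N where "N = (\<lambda>i j. coeff (u \<otimes> j \<otimes> v) i)"
  define T where "T = (\<lambda>i j. coeff (full \<otimes> j \<otimes> full) i)"
  define S where "S = {c \<in> J. c \<in> supp (u \<otimes> b \<otimes> v)}"
  have bB: "b \<in> B" using b supp_subset by blast
  have ab: "two_sided_le R B a b" using a b bB u v by (auto simp: two_sided_le_iff_supp)
  have aJ: "a \<in> J" using a two_sided_le_refl by (simp add: J_def)
  have bJ: "b \<in> J" using bB ab ba by (simp add: J_def)
  have "a \<in> S"
  proof (rule closed_set_reflects_edges[of J S N T b a])
    fix i j assume ij: "i \<in> J" "j \<in> J"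
    show "mat_prod J N T i j = mat_prod J T N i j"
      using ij a u v by (simp add: N_def T_def mat_prod_coeff[OF J_def])
    have "two_sided_le R B j i" using ij a two_sided_le_trans unfolding J_def by blast
    then show "1 \<le> T i j"
      using ij two_sided_le_iff_full[of j i] by (simp add: J_def T_def supp_def Suc_le_eq)
  next
    fix i assume "i \<in> J" then show "1 \<le> N i i"
      using refl[of i] by (simp add: J_def N_def supp_def Suc_le_eq)
  next
    fix i j assume "i \<in> J" "j \<in> S" "N i j \<noteq> 0"
    then show "i \<in> S"
      using trans[OF bB, of j i] by (auto simp: S_def J_def N_def supp_def)
  next
    show "finite J" using finite_basis by (simp add: J_def)
    show "S \<subseteq> J" by (auto simp: S_def)
    show "b \<in> S" using bJ bB refl by (simp add: S_def)
    show "a \<in> J" by (rule aJ)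
    show "N b a \<noteq> 0" using b by (simp add: N_def supp_def)
  qed
  then show ?thesis by (simp add: S_def)
qed

lemma left_le_symmetric_on_two_sided_cell:
  assumes "a \<in> B" "b \<in> B" "left_le R B a b" "two_sided_le R B b a"
  shows "left_le R B b a"
proof -
  have *: "left_le R B x y \<longleftrightarrow> y \<in> supp (full \<otimes> x \<otimes> \<one>)" if "x \<in> B" "y \<in> B" for x y
    using that by (simp add: left_le_iff_full)
  have "a \<in> supp (full \<otimes> b \<otimes> \<one>)"
  proof (rule one_sided_order_symmetric)
    fix x y z assume "x \<in> B" "y \<in> supp (full \<otimes> x \<otimes> \<one>)" "z \<in> supp (full \<otimes> y \<otimes> \<one>)"
    then show "z \<in> supp (full \<otimes> x \<otimes> \<one>)"
      using *[of x y] *[of y z] *[of x z] left_le_trans[of x y z] supp_subset by blast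
  qed (use assms * left_le_refl in auto)
  then show ?thesis using * assms by simp
qed

lemma right_le_symmetric_on_two_sided_cell:
  assumes "a \<in> B" "b \<in> B" "right_le R B a b" "two_sided_le R B b a"
  shows "right_le R B b a"
proof -
  have *: "right_le R B x y \<longleftrightarrow> y \<in> supp (\<one> \<otimes> x \<otimes> full)" if "x \<in> B" "y \<in> B" for x y
    using that by (simp add: right_le_iff_full)
  have "a \<in> supp (\<one> \<otimes> b \<otimes> full)"
  proof (rule one_sided_order_symmetric)
    fix x y z assume "x \<in> B" "y \<in> supp (\<one> \<otimes> x \<otimes> full)" "z \<in> supp (\<one> \<otimes> y \<otimes> full)"
    then show "z \<in> supp (\<one> \<otimes> x \<otimes> full)"
      using *[of x y] *[of y z] *[of x z] right_le_trans[of x y z] supp_subset by blast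
  qed (use assms * right_le_refl in auto)
  then show ?thesis using * assms by simp
qed
end

section \<open>Quotients of semimodules\<close>

locale semimodule_quotient = semimodule +
  fixes \<theta>
  assumes congruence: "semimodule_congruence R M \<theta>"
begin

abbreviation "Q \<equiv> quot_semimodule M \<theta>"

lemma equiv: "equiv (carrier M) \<theta>"
  using congruence by (simp add: semimodule_congruence_def)

lemma related_carrier: "(x, y) \<in> \<theta> \<Longrightarrow> x \<in> carrier M \<and> y \<in> carrier M"
  using equiv by (auto simp: equiv_def refl_on_def)

lemma related_add:
  assumes "(x, x') \<in> \<theta>" "(y, y') \<in> \<theta>"
  shows "(x \<oplus>\<^bsub>M\<^esub> y, x' \<oplus>\<^bsub>M\<^esub> y') \<in> \<theta>"
proof -
  note c = related_carrier[OF assms(1)] related_carrier[OF assms(2)]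
  have "(x \<oplus>\<^bsub>M\<^esub> y, x' \<oplus>\<^bsub>M\<^esub> y) \<in> \<theta>" "(y \<oplus>\<^bsub>M\<^esub> x', y' \<oplus>\<^bsub>M\<^esub> x') \<in> \<theta>"
    using congruence assms c by (auto simp: semimodule_congruence_def)
  moreover have "y \<oplus>\<^bsub>M\<^esub> x' = x' \<oplus>\<^bsub>M\<^esub> y" "y' \<oplus>\<^bsub>M\<^esub> x' = x' \<oplus>\<^bsub>M\<^esub> y'"
    using c by (simp_all add: M.a_comm)
  ultimately show ?thesis
    using equiv transD[of \<theta>] by (metis equivE)
qed

lemma related_smult:
  "(x, x') \<in> \<theta> \<Longrightarrow> r \<in> carrier R \<Longrightarrow> (r \<odot>\<^bsub>M\<^esub> x, r \<odot>\<^bsub>M\<^esub> x') \<in> \<theta>"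
  using congruence by (auto simp: semimodule_congruence_def)

lemma carrier_quot: "carrier Q = (\<lambda>x. \<theta> `` {x}) ` carrier M"
  by (auto simp: quot_semimodule_def quotient_def)

lemma zero_quot: "\<zero>\<^bsub>Q\<^esub> = \<theta> `` {\<zero>\<^bsub>M\<^esub>}"
  by (simp add: quot_semimodule_def)

lemma class_self: "x \<in> carrier M \<Longrightarrow> x \<in> \<theta> `` {x}"
  using equiv by (rule equiv_class_self)

lemma add_quot:
  assumes "x \<in> carrier M" "y \<in> carrier M"
  shows "\<theta> `` {x} \<oplus>\<^bsub>Q\<^esub> \<theta> `` {y} = \<theta> `` {x \<oplus>\<^bsub>M\<^esub> y}"
proof -
  have *: "\<theta> `` {x' \<oplus>\<^bsub>M\<^esub> y'} = \<theta> `` {x \<oplus>\<^bsub>M\<^esub> y}" if "x' \<in> \<theta> `` {x}" "y' \<in> \<theta> `` {y}" for x' y'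
    using equiv_class_eq[OF equiv related_add[of x x' y y']] that by simp
  have "\<theta> `` {x} \<oplus>\<^bsub>Q\<^esub> \<theta> `` {y} = (\<Union>x'\<in>\<theta> `` {x}. \<Union>y'\<in>\<theta> `` {y}. \<theta> `` {x' \<oplus>\<^bsub>M\<^esub> y'})"
    by (simp add: quot_semimodule_def)
  also have "\<dots> = (\<Union>x'\<in>\<theta> `` {x}. \<Union>y'\<in>\<theta> `` {y}. \<theta> `` {x \<oplus>\<^bsub>M\<^esub> y})"
    by (intro SUP_cong refl *)
  also have "\<dots> = \<theta> `` {x \<oplus>\<^bsub>M\<^esub> y}"
    using class_self[OF assms(1)] class_self[OF assms(2)] by blast
  finally show ?thesis .
qed

lemma smult_quot:
  assumes "x \<in> carrier M" "r \<in> carrier R"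
  shows "r \<odot>\<^bsub>Q\<^esub> \<theta> `` {x} = \<theta> `` {r \<odot>\<^bsub>M\<^esub> x}"
proof -
  have *: "\<theta> `` {r \<odot>\<^bsub>M\<^esub> x'} = \<theta> `` {r \<odot>\<^bsub>M\<^esub> x}" if "x' \<in> \<theta> `` {x}" for x'
    using equiv_class_eq[OF equiv related_smult[of x x' r]] that assms by simp
  have "r \<odot>\<^bsub>Q\<^esub> \<theta> `` {x} = (\<Union>x'\<in>\<theta> `` {x}. \<theta> `` {r \<odot>\<^bsub>M\<^esub> x'})"
    by (simp add: quot_semimodule_def)
  also have "\<dots> = (\<Union>x'\<in>\<theta> `` {x}. \<theta> `` {r \<odot>\<^bsub>M\<^esub> x})"
    by (intro SUP_cong refl *)
  also have "\<dots> = \<theta> `` {r \<odot>\<^bsub>M\<^esub> x}"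
    using class_self[OF assms(1)] by blast
  finally show ?thesis .
qed

lemma semimodule_quot: "semimodule R Q"
proof (intro semimodule.intro semimodule_axioms.intro abelian_monoidI)
  show "semiring R" by (rule R.semiring_axioms)
qed (auto simp: carrier_quot zero_quot add_quot smult_quot smult_closed smult_r_distr
    smult_r_null smult_l_distr smult_assoc smult_l_null smult_one M.a_ac)

end

lemma first_isomorphism:
  fixes R :: "('a, 'c) ring_scheme" and C :: "('a, 'n, 'e) module_scheme"
    and M :: "('a, 'm, 'd) module_scheme"
  assumes C: "semimodule R C" and M: "semimodule R M"
    and onto: "\<phi> ` carrier C = carrier M"
    and zero: "\<phi> \<zero>\<^bsub>C\<^esub> = \<zero>\<^bsub>M\<^esub>"
    and add: "\<And>x y. x \<in> carrier C \<Longrightarrow> y \<in> carrier C \<Longrightarrow> \<phi> (x \<oplus>\<^bsub>C\<^esub> y) = \<phi> x \<oplus>\<^bsub>M\<^esub> \<phi> y"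
    and smult: "\<And>r x. r \<in> carrier R \<Longrightarrow> x \<in> carrier C \<Longrightarrow> \<phi> (r \<odot>\<^bsub>C\<^esub> x) = r \<odot>\<^bsub>M\<^esub> \<phi> x"
  shows "\<exists>\<theta>. semimodule_congruence R C \<theta> \<and> semimodule_iso R M (quot_semimodule C \<theta>) \<noteq> {}"
proof -
  interpret C: semimodule R C by (rule C)
  define \<theta> where "\<theta> = {(x, y). x \<in> carrier C \<and> y \<in> carrier C \<and> \<phi> x = \<phi> y}"
  have "equiv (carrier C) \<theta>"
    by (auto simp: \<theta>_def intro!: equivI refl_onI symI transI)
  then have cong: "semimodule_congruence R C \<theta>"
    by (auto simp: semimodule_congruence_def \<theta>_def add smult C.smult_closed)
  interpret semimodule_quotient R C \<theta>
    by unfold_locales (rule cong)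
  define f where "f m = {x \<in> carrier C. \<phi> x = m}" for m
  have f: "f (\<phi> x) = \<theta> `` {x}" if "x \<in> carrier C" for x
    using that by (auto simp: f_def \<theta>_def)
  have "bij_betw f (carrier M) (carrier Q)"
  proof (rule bij_betwI')
    fix m n assume "m \<in> carrier M" "n \<in> carrier M"
    then obtain x where "x \<in> carrier C" "m = \<phi> x" unfolding onto[symmetric] by blast
    then have "x \<in> f m" by (simp add: f_def)
    then show "f m = f n \<longleftrightarrow> m = n" using \<open>m = \<phi> x\<close> by (metis (mono_tags, lifting) f_def mem_Collect_eq)
  next
    fix m assume "m \<in> carrier M"
    then show "f m \<in> carrier Q" unfolding onto[symmetric] carrier_quot using f by auto
  next
    fix X assume "X \<in> carrier Q"
    then show "\<exists>m\<in>carrier M. X = f m" unfolding onto[symmetric] carrier_quot using f by auto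
  qed
  moreover have "f \<zero>\<^bsub>M\<^esub> = \<zero>\<^bsub>Q\<^esub>"
    using f[of "\<zero>\<^bsub>C\<^esub>"] by (simp add: zero zero_quot)
  moreover have "f (m \<oplus>\<^bsub>M\<^esub> n) = f m \<oplus>\<^bsub>Q\<^esub> f n" if mn: "m \<in> carrier M" "n \<in> carrier M" for m n
  proof -
    from mn obtain x y where "x \<in> carrier C" "m = \<phi> x" "y \<in> carrier C" "n = \<phi> y"
      unfolding onto[symmetric] by blast
    then show ?thesis by (simp add: add[symmetric] f add_quot)
  qed
  moreover have "f (r \<odot>\<^bsub>M\<^esub> m) = r \<odot>\<^bsub>Q\<^esub> f m" if rm: "r \<in> carrier R" "m \<in> carrier M" for r m
  proof -
    from rm obtain x where "x \<in> carrier C" "m = \<phi> x"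
      unfolding onto[symmetric] by blast
    then show ?thesis using rm by (simp add: smult[symmetric] f smult_quot C.smult_closed)
  qed
  ultimately have "f \<in> semimodule_iso R M Q" by (simp add: semimodule_iso_def)
  then show ?thesis using cong by blast
qed

section \<open>Cell semimodules as power sets\<close>

context fg_nat_semiring begin

text \<open>These are the elements of the Boolean quotient, so that the quotient, and each cell semimodule
  inside it, becomes a set of subsets of the basis with union as addition.\<close>

definition supp_class :: "'a set \<Rightarrow> 'a set" where
  "supp_class S = {x \<in> carrier R. supp x = S}"

lemma supp_congruence_eq:
  "supp_congruence R B = {(x, y). x \<in> carrier R \<and> y \<in> carrier R \<and> supp x = supp y}"
  by (auto simp: supp_congruence_def supp_def)

lemma supp_congruence_class: "x \<in> carrier R \<Longrightarrow> supp_congruence R B `` {x} = supp_class (supp x)"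
  by (auto simp: supp_congruence_eq supp_class_def)

lemma sum_of_in_supp_class: "S \<subseteq> B \<Longrightarrow> sum_of S \<in> supp_class S"
  by (simp add: supp_class_def supp_sum_of)

lemma boolean_class_basis: "b \<in> B \<Longrightarrow> boolean_class R B b = supp_class {b}"
  by (simp add: boolean_class_def supp_congruence_class supp_basis)

lemma carrier_boolean_quot: "carrier (boolean_quot R B) = supp_class ` Pow B"
proof -
  have "carrier (boolean_quot R B) = (\<lambda>x. supp_class (supp x)) ` carrier R"
    by (auto simp: boolean_quot_def quot_semiring_def quotient_def supp_congruence_class)
  also have "\<dots> = supp_class ` Pow B"
  proof (intro equalityI subsetI)
    fix X assume "X \<in> supp_class ` Pow B"
    then obtain S where "S \<subseteq> B" "X = supp_class S" by auto
    then show "X \<in> (\<lambda>x. supp_class (supp x)) ` carrier R"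
      by (intro image_eqI[of _ _ "sum_of S"]) (simp_all add: supp_sum_of)
  qed (use supp_subset in auto)
  finally show ?thesis .
qed

lemma zero_boolean_quot: "\<zero>\<^bsub>boolean_quot R B\<^esub> = supp_class {}"
  by (simp add: boolean_quot_def quot_semiring_def supp_congruence_class supp_zero)

lemma add_boolean_quot:
  assumes "S \<subseteq> B" "T \<subseteq> B"
  shows "supp_class S \<oplus>\<^bsub>boolean_quot R B\<^esub> supp_class T = supp_class (S \<union> T)"
proof -
  have *: "supp_congruence R B `` {x \<oplus> y} = supp_class (S \<union> T)"
    if "x \<in> supp_class S" "y \<in> supp_class T" for x y
    using that by (simp add: supp_class_def[of S] supp_class_def[of T] supp_congruence_class supp_add)
  have "supp_class S \<oplus>\<^bsub>boolean_quot R B\<^esub> supp_class T =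
      (\<Union>x\<in>supp_class S. \<Union>y\<in>supp_class T. supp_congruence R B `` {x \<oplus> y})"
    by (simp add: boolean_quot_def quot_semiring_def)
  also have "\<dots> = (\<Union>x\<in>supp_class S. \<Union>y\<in>supp_class T. supp_class (S \<union> T))"
    by (intro SUP_cong refl *)
  also have "\<dots> = supp_class (S \<union> T)"
    using sum_of_in_supp_class[OF assms(1)] sum_of_in_supp_class[OF assms(2)] by blast
  finally show ?thesis .
qed

lemma mult_boolean_quot:
  assumes "r \<in> carrier R" "S \<subseteq> B"
  shows "boolean_class R B r \<otimes>\<^bsub>boolean_quot R B\<^esub> supp_class S = supp_class (\<Union>b\<in>S. supp (r \<otimes> b))"
proof -
  have *: "supp_congruence R B `` {x \<otimes> y} = supp_class (\<Union>b\<in>S. supp (r \<otimes> b))"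
    if "x \<in> supp_class (supp r)" "y \<in> supp_class S" for x y
  proof -
    have xy: "x \<in> carrier R" "supp x = supp r" "y \<in> carrier R" "supp y = S"
      using that by (auto simp: supp_class_def)
    have "supp (x \<otimes> y) = (\<Union>b\<in>S. supp (x \<otimes> b))" using xy by (simp add: supp_mult_right[of x y])
    also have "\<dots> = (\<Union>b\<in>S. supp (r \<otimes> b))"
      using xy assms by (intro SUP_cong refl) (subst (1 2) supp_mult_left, auto)
    finally show ?thesis using xy by (simp add: supp_congruence_class)
  qed
  have "r \<in> supp_class (supp r)" using assms by (simp add: supp_class_def)
  have "boolean_class R B r \<otimes>\<^bsub>boolean_quot R B\<^esub> supp_class S =
      (\<Union>x\<in>supp_class (supp r). \<Union>y\<in>supp_class S. supp_congruence R B `` {x \<otimes> y})"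
    using assms by (simp add: boolean_quot_def quot_semiring_def boolean_class_def supp_congruence_class)
  also have "\<dots> = (\<Union>x\<in>supp_class (supp r). \<Union>y\<in>supp_class S. supp_class (\<Union>b\<in>S. supp (r \<otimes> b)))"
    by (intro SUP_cong refl *)
  also have "\<dots> = supp_class (\<Union>b\<in>S. supp (r \<otimes> b))"
    using sum_of_in_supp_class[OF assms(2)] \<open>r \<in> supp_class (supp r)\<close> by blast
  finally show ?thesis .
qed

lemma abelian_monoid_boolean_quot: "abelian_monoid (boolean_quot R B)"
  by (rule abelian_monoidI)
    (auto simp: carrier_boolean_quot zero_boolean_quot add_boolean_quot Un_ac)

lemma finsum_boolean_quot:
  assumes "S \<subseteq> B"
  shows "(\<Oplus>\<^bsub>boolean_quot R B\<^esub>b\<in>S. boolean_class R B b) = supp_class S"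
  using finite_subset_basis[OF assms] assms
proof (induction S rule: finite_induct)
  interpret Q: abelian_monoid "boolean_quot R B" by (rule abelian_monoid_boolean_quot)
  {
    case empty
    show ?case by (simp add: zero_boolean_quot)
  next
    case (insert b S)
    have carr: "boolean_class R B c \<in> carrier (boolean_quot R B)" if "c \<in> B" for c
      using that by (simp add: boolean_class_basis carrier_boolean_quot)
    have "(\<Oplus>\<^bsub>boolean_quot R B\<^esub>b\<in>insert b S. boolean_class R B b) =
        boolean_class R B b \<oplus>\<^bsub>boolean_quot R B\<^esub> supp_class S"
      using insert carr by (subst Q.finsum_insert) auto
    then show ?case using insert by (simp add: boolean_class_basis add_boolean_quot)
  }
qed

lemma cell_proj_supp_class:
  assumes "L \<subseteq> B" "S \<subseteq> B"
  shows "cell_proj R B L (supp_class S) = supp_class (L \<inter> S)"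
proof -
  have "{b \<in> L. \<exists>x\<in>supp_class S. coeff x b \<noteq> 0} = L \<inter> S"
  proof (intro equalityI subsetI)
    fix b assume "b \<in> L \<inter> S"
    then show "b \<in> {b \<in> L. \<exists>x\<in>supp_class S. coeff x b \<noteq> 0}"
      using sum_of_in_supp_class[OF assms(2)] supp_sum_of[OF assms(2)] supp_def[of "sum_of S"] by blast
  next
    fix b assume "b \<in> {b \<in> L. \<exists>x\<in>supp_class S. coeff x b \<noteq> 0}"
    then obtain x where "b \<in> L" "x \<in> supp_class S" "coeff x b \<noteq> 0" by blast
    then have "b \<in> supp x" "supp x = S" using assms by (auto simp: supp_def[of x] supp_class_def[of S])
    then show "b \<in> L \<inter> S" using \<open>b \<in> L\<close> by simp
  qed
  then show ?thesis using assms by (simp add: cell_proj_def finsum_boolean_quot le_infI1)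
qed

lemma carrier_cell_semimodule:
  assumes "L \<subseteq> B"
  shows "carrier (cell_semimodule R B L) = supp_class ` Pow L"
proof -
  let ?A = "add_monoid (boolean_quot R B)"
  have "submonoid (supp_class ` Pow L) ?A"
  proof
    show "supp_class ` Pow L \<subseteq> carrier ?A" using assms by (auto simp: carrier_boolean_quot)
    fix X Y assume "X \<in> supp_class ` Pow L" "Y \<in> supp_class ` Pow L"
    then obtain S T where "S \<subseteq> L" "T \<subseteq> L" "X = supp_class S" "Y = supp_class T" by auto
    then show "X \<otimes>\<^bsub>?A\<^esub> Y \<in> supp_class ` Pow L" using assms by (simp add: add_boolean_quot)
  qed (simp add: zero_boolean_quot)
  moreover have "boolean_class R B ` L \<subseteq> supp_class ` Pow L"
    using assms by (auto simp: boolean_class_basis)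
  moreover have "supp_class S \<in> N"
    if N: "submonoid N ?A" "boolean_class R B ` L \<subseteq> N" and "S \<subseteq> L" for N S
  proof -
    interpret N: submonoid N ?A by (rule N)
    have "finite S" using \<open>S \<subseteq> L\<close> assms finite_subset_basis by blast
    then show ?thesis using \<open>S \<subseteq> L\<close>
    proof (induction S)
      case empty
      show ?case using N.one_closed by (simp add: zero_boolean_quot)
    next
      case (insert b S)
      have "boolean_class R B b \<in> N" using N(2) insert by auto
      then have "supp_class {b} \<in> N" using insert assms by (auto simp: boolean_class_basis)
      then have "supp_class {b} \<oplus>\<^bsub>boolean_quot R B\<^esub> supp_class S \<in> N"
        using N.m_closed insert by auto
      moreover have "{b} \<subseteq> B" "S \<subseteq> B" using insert assms by auto
      ultimately show ?case by (simp add: add_boolean_quot)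
    qed
  qed
  ultimately show ?thesis by (auto simp: cell_semimodule_def)
qed

lemma zero_cell_semimodule: "\<zero>\<^bsub>cell_semimodule R B L\<^esub> = supp_class {}"
  by (simp add: cell_semimodule_def zero_boolean_quot)

lemma add_cell_semimodule:
  "S \<subseteq> B \<Longrightarrow> T \<subseteq> B \<Longrightarrow>
    supp_class S \<oplus>\<^bsub>cell_semimodule R B L\<^esub> supp_class T = supp_class (S \<union> T)"
  by (simp add: cell_semimodule_def add_boolean_quot)

lemma smult_cell_semimodule:
  assumes "L \<subseteq> B" "S \<subseteq> B" "r \<in> carrier R"
  shows "r \<odot>\<^bsub>cell_semimodule R B L\<^esub> supp_class S = supp_class (L \<inter> (\<Union>b\<in>S. supp (r \<otimes> b)))"
proof -
  have "(\<Union>b\<in>S. supp (r \<otimes> b)) \<subseteq> B" using supp_subset by blast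
  then show ?thesis
    using assms by (simp add: cell_semimodule_def mult_boolean_quot cell_proj_supp_class)
qed

lemma left_cell_iff:
  "L \<in> left_cells R B \<longleftrightarrow> (\<exists>a\<in>B. L = {b \<in> B. left_le R B a b \<and> left_le R B b a})"
  by (auto simp: left_cells_def preorder_classes_def quotient_def)

lemma right_cell_iff:
  "K \<in> right_cells R B \<longleftrightarrow> (\<exists>a\<in>B. K = {b \<in> B. right_le R B a b \<and> right_le R B b a})"
  by (auto simp: right_cells_def preorder_classes_def quotient_def)

lemma two_sided_cell_iff:
  "J \<in> two_sided_cells R B \<longleftrightarrow> (\<exists>a\<in>B. J = {b \<in> B. two_sided_le R B a b \<and> two_sided_le R B b a})"
  by (auto simp: two_sided_cells_def preorder_classes_def quotient_def)

lemma left_cell_subset: "L \<in> left_cells R B \<Longrightarrow> L \<subseteq> B"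
  by (auto simp: left_cell_iff)

lemma left_cell_le: "L \<in> left_cells R B \<Longrightarrow> a \<in> L \<Longrightarrow> b \<in> L \<Longrightarrow> left_le R B a b"
  using left_le_trans[of a _ b] by (auto simp: left_cell_iff)

lemma left_cell_convex:
  assumes "L \<in> left_cells R B" "a \<in> L" "c \<in> L" "b \<in> B" "left_le R B a b" "left_le R B b c"
  shows "b \<in> L"
proof -
  obtain d where d: "d \<in> B" "L = {b \<in> B. left_le R B d b \<and> left_le R B b d}"
    using assms left_cell_iff by blast
  have "left_le R B d b" "left_le R B b d"
    using left_le_trans[of d a b] left_le_trans[of b c d] d assms by auto
  then show ?thesis using d assms by simp
qed

text \<open>Associativity holds although the action cuts off terms outside \<open>L\<close>: a left cell is convex, so a
  term that has left \<open>L\<close> never contributes to \<open>L\<close> again.\<close>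

lemma semimodule_cell_semimodule:
  assumes L: "L \<in> left_cells R B"
  shows "semimodule R (cell_semimodule R B L)"
proof -
  let ?C = "cell_semimodule R B L"
  note LB = left_cell_subset[OF L]
  have assoc: "L \<inter> (\<Union>b\<in>S. supp (r \<otimes> s \<otimes> b)) =
      L \<inter> (\<Union>c\<in>L \<inter> (\<Union>b\<in>S. supp (s \<otimes> b)). supp (r \<otimes> c))"
    if rs: "r \<in> carrier R" "s \<in> carrier R" and S: "S \<subseteq> L" for r s S
  proof -
    have eq: "supp (r \<otimes> s \<otimes> b) = (\<Union>c\<in>supp (s \<otimes> b). supp (r \<otimes> c))" if "b \<in> S" for b
      using that rs S LB by (subst m_assoc, (auto)[3], subst supp_mult_right) auto
    have inL: "c \<in> L" if "b \<in> S" "c \<in> supp (s \<otimes> b)" "d \<in> supp (r \<otimes> c)" "d \<in> L" for b c d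
    proof (rule left_cell_convex[OF L, of b d])
      show cB: "c \<in> B" using that supp_subset by blast
      show "left_le R B b c" using that(2) cB rs by (auto simp: left_le_iff_supp)
      have "d \<in> B" using that LB by auto
      then show "left_le R B c d" using that(3) rs(1) left_le_iff_supp by blast
    qed (use that S in auto)
    have *: "L \<inter> supp (r \<otimes> s \<otimes> b) = L \<inter> (\<Union>c\<in>L \<inter> supp (s \<otimes> b). supp (r \<otimes> c))" if "b \<in> S" for b
      using inL[OF that] unfolding eq[OF that] by blast
    have "L \<inter> (\<Union>b\<in>S. supp (r \<otimes> s \<otimes> b)) = (\<Union>b\<in>S. L \<inter> supp (r \<otimes> s \<otimes> b))"
      by blast
    also have "\<dots> = (\<Union>b\<in>S. L \<inter> (\<Union>c\<in>L \<inter> supp (s \<otimes> b). supp (r \<otimes> c)))"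
      by (intro SUP_cong refl *)
    finally show ?thesis by blast
  qed
  have sub: "S \<subseteq> L \<Longrightarrow> S \<subseteq> B" for S using LB by blast
  show ?thesis
  proof (intro semimodule.intro semimodule_axioms.intro abelian_monoidI)
    show "semiring R" by (rule semiring_axioms)
  next
    fix r s X assume rs: "r \<in> carrier R" "s \<in> carrier R" and "X \<in> carrier ?C"
    then obtain S where S: "S \<subseteq> L" "X = supp_class S" by (auto simp: carrier_cell_semimodule LB)
    have "supp ((r \<oplus> s) \<otimes> b) = supp (r \<otimes> b) \<union> supp (s \<otimes> b)" if "b \<in> S" for b
      using that rs S LB by (auto simp: l_distr supp_add)
    then have "(\<Union>b\<in>S. supp ((r \<oplus> s) \<otimes> b)) = (\<Union>b\<in>S. supp (r \<otimes> b)) \<union> (\<Union>b\<in>S. supp (s \<otimes> b))"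
      by auto
    then show "(r \<oplus> s) \<odot>\<^bsub>?C\<^esub> X = r \<odot>\<^bsub>?C\<^esub> X \<oplus>\<^bsub>?C\<^esub> s \<odot>\<^bsub>?C\<^esub> X"
      using rs S LB by (simp add: smult_cell_semimodule sub add_cell_semimodule Int_Un_distrib)
    show "(r \<otimes> s) \<odot>\<^bsub>?C\<^esub> X = r \<odot>\<^bsub>?C\<^esub> (s \<odot>\<^bsub>?C\<^esub> X)"
      using rs S LB by (simp add: smult_cell_semimodule sub assoc)
  next
    fix X assume "X \<in> carrier ?C"
    then obtain S where S: "S \<subseteq> L" "X = supp_class S" by (auto simp: carrier_cell_semimodule LB)
    have "supp (\<one> \<otimes> b) = {b}" "supp (\<zero> \<otimes> b) = {}" if "b \<in> S" for b
      using that S LB by (auto simp: supp_basis supp_zero)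
    then have "(\<Union>b\<in>S. supp (\<one> \<otimes> b)) = S" "(\<Union>b\<in>S. supp (\<zero> \<otimes> b)) = {}"
      by auto
    then show "\<one> \<odot>\<^bsub>?C\<^esub> X = X" "\<zero> \<odot>\<^bsub>?C\<^esub> X = \<zero>\<^bsub>?C\<^esub>"
      using S LB by (simp_all add: smult_cell_semimodule sub Int_absorb1 zero_cell_semimodule)
  qed (auto simp: carrier_cell_semimodule LB sub add_cell_semimodule zero_cell_semimodule
      smult_cell_semimodule Un_ac Int_Un_distrib)
qed

section \<open>Minimality of quotients of cell semimodules\<close>

text \<open>Idempotency provides some product of elements of \<open>J\<close> that meets \<open>J\<close>; its second factor occurs in
  some \<open>r b s\<close>.  Unfolding this gives \<open>k\<close> and \<open>w\<close> with \<open>w\<close> in the support of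
  \<open>k b\<close>, both squeezed into \<open>J\<close>, and symmetry of the left order on \<open>J\<close> moves \<open>w\<close> from above \<open>b\<close>
  into the left cell of \<open>b\<close>.\<close>

lemma exists_acting_element:
  assumes L: "L \<in> left_cells R B" and b: "b \<in> L"
    and J: "J = {c \<in> B. two_sided_le R B b c \<and> two_sided_le R B c b}"
    and idem: "idempotent_cell R B J"
  shows "\<exists>e\<in>J. L \<inter> supp (e \<otimes> b) \<noteq> {}"
proof -
  have bB: "b \<in> B" using L b left_cell_subset by blast
  obtain x y z where xyz: "x \<in> J" "y \<in> J" "z \<in> J" "z \<in> supp (x \<otimes> y)"
    using idem J by (auto simp: idempotent_cell_def supp_def)
  then have xB: "x \<in> B" and yB: "y \<in> B" and zB: "z \<in> B" using J by auto
  obtain r s where rs: "r \<in> carrier R" "s \<in> carrier R" "y \<in> supp (r \<otimes> b \<otimes> s)"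
    using xyz J by (auto simp: two_sided_le_iff_supp)
  have "z \<in> supp (x \<otimes> (r \<otimes> b \<otimes> s))"
    using rs xyz xB bB by (subst supp_mult_right) auto
  also have "x \<otimes> (r \<otimes> b \<otimes> s) = (x \<otimes> r) \<otimes> (b \<otimes> s)"
    using rs xB bB by (simp add: m_assoc)
  also have "supp \<dots> = (\<Union>k\<in>supp (x \<otimes> r). supp (k \<otimes> (b \<otimes> s)))"
    using rs xB bB by (intro supp_mult_left) auto
  finally obtain k where k: "k \<in> supp (x \<otimes> r)" "z \<in> supp (k \<otimes> (b \<otimes> s))" by blast
  then have kB: "k \<in> B" using supp_subset by blast
  have "supp (k \<otimes> (b \<otimes> s)) = (\<Union>w\<in>supp (k \<otimes> b). supp (w \<otimes> s))"
    using rs kB bB supp_mult_left[of s "k \<otimes> b"] by (simp add: m_assoc)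
  then obtain w where w: "w \<in> supp (k \<otimes> b)" "z \<in> supp (w \<otimes> s)" using k by blast
  then have wB: "w \<in> B" using supp_subset by blast
  have bw: "left_le R B b w" using w wB kB by (auto simp: left_le_iff_supp)
  have wz: "two_sided_le R B w z"
    using w wB zB rs right_le_imp_two_sided_le by (auto simp: right_le_iff_supp)
  have xk: "two_sided_le R B x k"
    using k xB kB rs right_le_imp_two_sided_le by (auto simp: right_le_iff_supp)
  have "right_le R B k z" using k kB zB rs bB m_closed[of b s] by (auto simp: right_le_iff_supp)
  then have kz: "two_sided_le R B k z" using kB zB right_le_imp_two_sided_le by blast
  have bx: "two_sided_le R B b x" and zb: "two_sided_le R B z b" using xyz J by auto
  have "two_sided_le R B w b" using two_sided_le_trans[OF wB zB bB wz zb] .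
  then have "left_le R B w b" using left_le_symmetric_on_two_sided_cell bw wB bB by blast
  then have "w \<in> L" using left_cell_convex[OF L b b wB bw] by blast
  moreover have "k \<in> J"
    using two_sided_le_trans[OF bB xB kB bx xk] two_sided_le_trans[OF kB zB bB kz zb] kB
    by (simp add: J)
  ultimately show ?thesis using w by blast
qed

text \<open>Elements of \<open>L\<close> in the support of \<open>e c\<close> lie above \<open>e\<close> in the right order and in the same two-sided
  cell, hence in the right cell of \<open>e\<close>, which meets \<open>L\<close> in one point only.  Taking \<open>e\<close> in the
  right cell of \<open>b'\<close> makes this point \<open>b'\<close>; taking it in the left cell of an element that acts
  non-trivially on \<open>b\<close> makes \<open>e b\<close> non-zero.\<close>

lemma exists_matrix_unit:
  assumes cells: "\<forall>J\<in>two_sided_cells R B. strongly_regular_cell R B J \<and> idempotent_cell R B J"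
    and L: "L \<in> left_cells R B" and b: "b \<in> L" and b': "b' \<in> L"
  shows "\<exists>e\<in>B. b' \<in> supp (e \<otimes> b) \<and> (\<forall>c\<in>L. L \<inter> supp (e \<otimes> c) \<subseteq> {b'})"
proof -
  note LB = left_cell_subset[OF L]
  have bB: "b \<in> B" "b' \<in> B" using b b' LB by auto
  define J where "J = {c \<in> B. two_sided_le R B b c \<and> two_sided_le R B c b}"
  have JB: "c \<in> B" if "c \<in> J" for c using that by (simp add: J_def)
  have JJ: "two_sided_le R B c d" if "c \<in> J" "d \<in> J" for c d
    using that bB two_sided_le_trans[of c b d] by (simp add: J_def)
  have J_convex: "d \<in> J" if "c \<in> J" "d \<in> B" "two_sided_le R B c d" "two_sided_le R B d c" for c d
    using that bB two_sided_le_trans[of b c d] two_sided_le_trans[of d c b] by (simp add: J_def)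
  have "J \<in> two_sided_cells R B" using bB by (auto simp: two_sided_cell_iff J_def)
  then have reg: "strongly_regular_cell R B J" and idem: "idempotent_cell R B J"
    using cells by auto
  have LJ: "L \<subseteq> J"
  proof
    fix c assume "c \<in> L"
    then show "c \<in> J" using left_cell_le[OF L] left_le_imp_two_sided_le b bB(1) LB
      by (simp add: J_def subset_iff)
  qed
  obtain e0 w where e0: "e0 \<in> J" and w: "w \<in> L" "w \<in> supp (e0 \<otimes> b)"
    using exists_acting_element[OF L b J_def idem] by blast
  define K where "K = {c \<in> B. right_le R B b' c \<and> right_le R B c b'}"
  define L0 where "L0 = {c \<in> B. left_le R B e0 c \<and> left_le R B c e0}"
  have b'J: "b' \<in> J" using b' LJ by blast
  have K: "K \<in> right_cells R B" "K \<subseteq> J"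
    using bB b'J J_convex[of b'] right_le_imp_two_sided_le by (auto simp: right_cell_iff K_def)
  have L0: "L0 \<in> left_cells R B" "L0 \<subseteq> J"
    using JB[OF e0] e0 J_convex[of e0] left_le_imp_two_sided_le by (auto simp: left_cell_iff L0_def)
  have "is_singleton (L0 \<inter> K)" using reg K L0 by (simp add: strongly_regular_cell_def)
  then obtain e where e: "e \<in> L0" "e \<in> K" unfolding is_singleton_def by blast
  then have eB: "e \<in> B" by (simp add: K_def)
  have only: "d = b'" if "c \<in> L" "d \<in> L" "d \<in> supp (e \<otimes> c)" for c d
  proof -
    have dB: "d \<in> B" "c \<in> B" using that LB by auto
    have ed: "right_le R B e d" using that dB by (auto simp: right_le_iff_supp)
    have "two_sided_le R B d e" using that LJ e L0 JJ by blast
    then have "right_le R B d e"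
      using right_le_symmetric_on_two_sided_cell ed eB dB by blast
    then have "d \<in> K"
      using right_le_trans[of d e b'] right_le_trans[of b' e d] ed e eB dB bB by (simp add: K_def)
    then have "d \<in> L \<inter> K" using that(2) by simp
    moreover have "b' \<in> L \<inter> K" using b' bB right_le_refl by (simp add: K_def)
    moreover have "is_singleton (L \<inter> K)" using reg L LJ K by (simp add: strongly_regular_cell_def)
    ultimately show ?thesis by (metis is_singletonE singletonD)
  qed
  have "b' \<in> supp (e \<otimes> b)"
  proof -
    have "left_le R B e e0" using e by (simp add: L0_def)
    then obtain r where r: "r \<in> carrier R" "e0 \<in> supp (r \<otimes> e)"
      using JB[OF e0] by (auto simp: left_le_iff_supp)
    have "w \<in> supp ((r \<otimes> e) \<otimes> b)"
      using w r eB bB by (subst supp_mult_left) auto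
    also have "(r \<otimes> e) \<otimes> b = r \<otimes> (e \<otimes> b)" using r eB bB by (simp add: m_assoc)
    also have "supp \<dots> = (\<Union>v\<in>supp (e \<otimes> b). supp (r \<otimes> v))"
      using r eB bB by (intro supp_mult_right) auto
    finally obtain v where v: "v \<in> supp (e \<otimes> b)" "w \<in> supp (r \<otimes> v)" by blast
    then have vB: "v \<in> B" using supp_subset by blast
    have "v \<in> L"
    proof (rule left_cell_convex[OF L b w(1) vB])
      show "left_le R B b v" using v vB eB by (auto simp: left_le_iff_supp)
      have "w \<in> B" using w LB by auto
      then show "left_le R B v w" using v r left_le_iff_supp by blast
    qed
    then show ?thesis using only[OF b _ v(1)] v(1) by blast
  qed
  then show ?thesis using only eB by blast
qed

lemma quotient_of_cell_semimodule_minimal: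
  assumes cells: "\<forall>J\<in>two_sided_cells R B. strongly_regular_cell R B J \<and> idempotent_cell R B J"
    and L: "L \<in> left_cells R B"
    and \<theta>: "semimodule_congruence R (cell_semimodule R B L) \<theta>"
    and nonzero: "carrier (quot_semimodule (cell_semimodule R B L) \<theta>) \<noteq>
      {\<zero>\<^bsub>quot_semimodule (cell_semimodule R B L) \<theta>\<^esub>}"
  shows "minimal_semimodule R (quot_semimodule (cell_semimodule R B L) \<theta>)"
proof -
  let ?C = "cell_semimodule R B L"
  note LB = left_cell_subset[OF L]
  interpret C: semimodule R ?C by (rule semimodule_cell_semimodule[OF L])
  interpret quo: semimodule_quotient R ?C \<theta> by unfold_locales (rule \<theta>)
  have inC: "supp_class S \<in> carrier ?C" if "S \<subseteq> L" for S
    using that LB by (auto simp: carrier_cell_semimodule)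
  have "N = carrier quo.Q" if N: "subsemimodule N R quo.Q" and ne: "N \<noteq> {\<zero>\<^bsub>quo.Q\<^esub>}" for N
  proof
    interpret N: submonoid N "add_monoid quo.Q" using N by (simp add: subsemimodule_def)
    show "N \<subseteq> carrier quo.Q" using N.subset by simp
    have "\<zero>\<^bsub>quo.Q\<^esub> \<in> N" using N.one_closed by simp
    then obtain X where X: "X \<in> N" "X \<noteq> \<zero>\<^bsub>quo.Q\<^esub>" using ne by blast
    then have "X \<in> carrier quo.Q" using N.subset by auto
    then obtain S where S: "S \<subseteq> L" "X = \<theta> `` {supp_class S}"
      using LB by (auto simp: quo.carrier_quot carrier_cell_semimodule)
    have "S \<noteq> {}" using X S by (auto simp: quo.zero_quot zero_cell_semimodule)
    then obtain b where b: "b \<in> S" by blast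
    have single: "\<theta> `` {supp_class {b'}} \<in> N" if b': "b' \<in> L" for b'
    proof -
      obtain e where e: "e \<in> B" "b' \<in> supp (e \<otimes> b)" "\<forall>c\<in>L. L \<inter> supp (e \<otimes> c) \<subseteq> {b'}"
        using exists_matrix_unit[OF cells L _ b', of b] b S by blast
      have "L \<inter> (\<Union>c\<in>S. supp (e \<otimes> c)) = {b'}" using e b b' S by blast
      then have "e \<odot>\<^bsub>?C\<^esub> supp_class S = supp_class {b'}"
        using e S LB by (subst smult_cell_semimodule) auto
      then have "e \<odot>\<^bsub>quo.Q\<^esub> X = \<theta> `` {supp_class {b'}}"
        using S e inC by (simp add: quo.smult_quot)
      moreover have "e \<odot>\<^bsub>quo.Q\<^esub> X \<in> N"
        using N X e by (simp add: subsemimodule_def)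
      ultimately show ?thesis by simp
    qed
    have all: "\<theta> `` {supp_class T} \<in> N" if "finite T" "T \<subseteq> L" for T
      using that
    proof (induction T)
      case empty
      show ?case using N.one_closed by (simp add: quo.zero_quot zero_cell_semimodule)
    next
      case (insert c T)
      have "\<theta> `` {supp_class {c}} \<oplus>\<^bsub>quo.Q\<^esub> \<theta> `` {supp_class T} \<in> N"
        using N.m_closed single insert by auto
      moreover have "\<theta> `` {supp_class {c}} \<oplus>\<^bsub>quo.Q\<^esub> \<theta> `` {supp_class T} =
          \<theta> `` {supp_class {c} \<oplus>\<^bsub>?C\<^esub> supp_class T}"
        using insert inC by (intro quo.add_quot) auto
      moreover have "supp_class {c} \<oplus>\<^bsub>?C\<^esub> supp_class T = supp_class (insert c T)"
        using insert LB by (subst add_cell_semimodule) auto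
      ultimately show ?case by simp
    qed
    have "\<theta> `` {supp_class T} \<in> N" if "T \<subseteq> L" for T
      using all[OF finite_subset_basis that] that LB by blast
    then show "carrier quo.Q \<subseteq> N"
      using LB by (auto simp: quo.carrier_quot carrier_cell_semimodule)
  qed
  then show ?thesis
    using nonzero quo.semimodule_quot by (auto simp: minimal_semimodule_def)
qed

end

section \<open>Minimal proper semimodules\<close>

locale minimal_proper_semimodule = fg_nat_semiring R B + semimodule R M
  for R (structure) and B and M (structure) +
  assumes minimal: "minimal_semimodule R M" and proper: "\<not> abelian_group M"
begin

lemma subsemimodule_eq_carrier:
  "subsemimodule N R M \<Longrightarrow> x \<in> N \<Longrightarrow> x \<noteq> \<zero>\<^bsub>M\<^esub> \<Longrightarrow> N = carrier M"
  using minimal unfolding minimal_semimodule_def by blast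

lemma subsemimoduleI:
  assumes "N \<subseteq> carrier M" "\<zero>\<^bsub>M\<^esub> \<in> N" "\<And>x y. x \<in> N \<Longrightarrow> y \<in> N \<Longrightarrow> x \<oplus>\<^bsub>M\<^esub> y \<in> N"
    "\<And>r x. r \<in> carrier R \<Longrightarrow> x \<in> N \<Longrightarrow> r \<odot>\<^bsub>M\<^esub> x \<in> N"
  shows "subsemimodule N R M"
  unfolding subsemimodule_def using assms by (auto intro!: submonoid.intro)

lemma generated_by_nonzero:
  assumes "x \<in> carrier M" "x \<noteq> \<zero>\<^bsub>M\<^esub>" "y \<in> carrier M"
  shows "\<exists>r\<in>carrier R. y = r \<odot>\<^bsub>M\<^esub> x"
proof -
  define N where "N = (\<lambda>r. r \<odot>\<^bsub>M\<^esub> x) ` carrier R"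
  have "subsemimodule N R M"
  proof (rule subsemimoduleI)
    show "N \<subseteq> carrier M" using assms by (auto simp: N_def smult_closed)
    show "\<zero>\<^bsub>M\<^esub> \<in> N" using assms by (auto simp: N_def smult_l_null intro!: image_eqI[of _ _ \<zero>])
  next
    fix y z assume "y \<in> N" "z \<in> N"
    then obtain r s where "r \<in> carrier R" "s \<in> carrier R" "y = r \<odot>\<^bsub>M\<^esub> x" "z = s \<odot>\<^bsub>M\<^esub> x"
      by (auto simp: N_def)
    then show "y \<oplus>\<^bsub>M\<^esub> z \<in> N"
      using assms by (auto simp: N_def smult_l_distr intro!: image_eqI[of _ _ "r \<oplus> s"])
  next
    fix t y assume "t \<in> carrier R" "y \<in> N"
    then obtain r where "r \<in> carrier R" "y = r \<odot>\<^bsub>M\<^esub> x" by (auto simp: N_def)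
    then show "t \<odot>\<^bsub>M\<^esub> y \<in> N" using assms \<open>t \<in> carrier R\<close>
      by (auto simp: N_def smult_assoc intro!: image_eqI[of _ _ "t \<otimes> r"])
  qed
  moreover have "x \<in> N" using assms by (auto simp: N_def smult_one intro!: image_eqI[of _ _ \<one>])
  ultimately have "N = carrier M" using assms subsemimodule_eq_carrier by blast
  then show ?thesis using assms by (auto simp: N_def)
qed

text \<open>Otherwise the additively invertible elements form a non-zero subsemimodule, so that \<open>M\<close> is a
  group.\<close>

lemma zero_sum_free:
  assumes "x \<in> carrier M" "y \<in> carrier M" "x \<oplus>\<^bsub>M\<^esub> y = \<zero>\<^bsub>M\<^esub>"
  shows "x = \<zero>\<^bsub>M\<^esub>"
proof (rule ccontr)
  assume "x \<noteq> \<zero>\<^bsub>M\<^esub>"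
  define U where "U = {x \<in> carrier M. \<exists>y\<in>carrier M. y \<oplus>\<^bsub>M\<^esub> x = \<zero>\<^bsub>M\<^esub>}"
  have "subsemimodule U R M"
  proof (rule subsemimoduleI)
    show "U \<subseteq> carrier M" "\<zero>\<^bsub>M\<^esub> \<in> U" by (auto simp: U_def)
  next
    fix x y assume "x \<in> U" "y \<in> U"
    then obtain x' y' where xy: "x \<in> carrier M" "y \<in> carrier M" "x' \<in> carrier M" "y' \<in> carrier M"
      "x' \<oplus>\<^bsub>M\<^esub> x = \<zero>\<^bsub>M\<^esub>" "y' \<oplus>\<^bsub>M\<^esub> y = \<zero>\<^bsub>M\<^esub>"
      by (auto simp: U_def)
    have "(x' \<oplus>\<^bsub>M\<^esub> y') \<oplus>\<^bsub>M\<^esub> (x \<oplus>\<^bsub>M\<^esub> y) = (x' \<oplus>\<^bsub>M\<^esub> x) \<oplus>\<^bsub>M\<^esub> (y' \<oplus>\<^bsub>M\<^esub> y)"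
      using xy(1-4) by (simp add: M.a_ac)
    also have "\<dots> = \<zero>\<^bsub>M\<^esub>" using xy by simp
    finally show "x \<oplus>\<^bsub>M\<^esub> y \<in> U" using xy by (auto simp: U_def)
  next
    fix r x assume r: "r \<in> carrier R" and "x \<in> U"
    then obtain x' where x: "x \<in> carrier M" "x' \<in> carrier M" "x' \<oplus>\<^bsub>M\<^esub> x = \<zero>\<^bsub>M\<^esub>"
      by (auto simp: U_def)
    then have "r \<odot>\<^bsub>M\<^esub> x' \<oplus>\<^bsub>M\<^esub> r \<odot>\<^bsub>M\<^esub> x = \<zero>\<^bsub>M\<^esub>"
      using r by (simp add: smult_r_distr[symmetric] smult_r_null)
    then show "r \<odot>\<^bsub>M\<^esub> x \<in> U" using r x by (auto simp: U_def smult_closed)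
  qed
  moreover have "x \<in> U" using assms M.a_comm[of x y] by (auto simp: U_def)
  ultimately have "U = carrier M" using \<open>x \<noteq> \<zero>\<^bsub>M\<^esub>\<close> subsemimodule_eq_carrier by blast
  then have "\<exists>y\<in>carrier M. y \<oplus>\<^bsub>M\<^esub> x = \<zero>\<^bsub>M\<^esub>" if "x \<in> carrier M" for x
    using that by (auto simp: U_def)
  then have "abelian_group M"
    by (intro abelian_groupI) (simp_all add: M.a_ac)
  then show False using proper by simp
qed

lemma smult_add_pow:
  assumes "r \<in> carrier R" "x \<in> carrier M"
  shows "r \<odot>\<^bsub>M\<^esub> ([(n :: nat)] \<cdot>\<^bsub>M\<^esub> x) = [n] \<cdot>\<^bsub>M\<^esub> (r \<odot>\<^bsub>M\<^esub> x)"
  using assms by (induction n) (auto simp: smult_r_null smult_r_distr smult_closed)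

lemma add_pow_smult:
  assumes "r \<in> carrier R" "x \<in> carrier M"
  shows "([(n :: nat)] \<cdot> r) \<odot>\<^bsub>M\<^esub> x = [n] \<cdot>\<^bsub>M\<^esub> (r \<odot>\<^bsub>M\<^esub> x)"
  using assms by (induction n) (auto simp: smult_l_null smult_l_distr smult_closed)

text \<open>The multiples by \<open>n\<close> form a subsemimodule, non-zero as \<open>M\<close> is zero-sum-free.\<close>

lemma divisible:
  assumes "x \<in> carrier M" "0 < n"
  shows "\<exists>y\<in>carrier M. x = [(n :: nat)] \<cdot>\<^bsub>M\<^esub> y"
proof (cases "x = \<zero>\<^bsub>M\<^esub>")
  case False
  define N where "N = (\<lambda>y. [n] \<cdot>\<^bsub>M\<^esub> y) ` carrier M"
  have "subsemimodule N R M"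
  proof (rule subsemimoduleI)
    show "N \<subseteq> carrier M" by (auto simp: N_def)
    show "\<zero>\<^bsub>M\<^esub> \<in> N" by (auto simp: N_def intro!: image_eqI[of _ _ "\<zero>\<^bsub>M\<^esub>"])
  next
    fix y z assume "y \<in> N" "z \<in> N"
    then obtain u v where "u \<in> carrier M" "v \<in> carrier M" "y = [n] \<cdot>\<^bsub>M\<^esub> u" "z = [n] \<cdot>\<^bsub>M\<^esub> v"
      by (auto simp: N_def)
    then show "y \<oplus>\<^bsub>M\<^esub> z \<in> N"
      by (auto simp: N_def M.add.nat_pow_distrib intro!: image_eqI[of _ _ "u \<oplus>\<^bsub>M\<^esub> v"])
  next
    fix r y assume "r \<in> carrier R" "y \<in> N"
    then show "r \<odot>\<^bsub>M\<^esub> y \<in> N" by (auto simp: N_def smult_add_pow smult_closed)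
  qed
  moreover have "[n] \<cdot>\<^bsub>M\<^esub> x \<in> N" using assms by (simp add: N_def)
  moreover have "[n] \<cdot>\<^bsub>M\<^esub> x \<noteq> \<zero>\<^bsub>M\<^esub>"
  proof
    assume "[n] \<cdot>\<^bsub>M\<^esub> x = \<zero>\<^bsub>M\<^esub>"
    then have "x \<oplus>\<^bsub>M\<^esub> [(n - 1)] \<cdot>\<^bsub>M\<^esub> x = \<zero>\<^bsub>M\<^esub>"
      using assms M.add.nat_pow_Suc2[of x "n - 1"] by simp
    then show False using zero_sum_free[OF assms(1)] False assms by auto
  qed
  ultimately have "N = carrier M" using subsemimodule_eq_carrier by blast
  then show ?thesis using assms by (auto simp: N_def)
qed (auto intro!: bexI[of _ "\<zero>\<^bsub>M\<^esub>"])

text \<open>Write \<open>x = (n + 1) (r\<^sub>n x)\<close> for all \<open>n\<close>.  Infinitely many of the \<open>r\<^sub>n\<close> have the same support as some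
  \<open>r\<^sub>k\<close>, so \<open>r\<^sub>k x\<close> is a summand of \<open>c (r\<^sub>l x)\<close> with \<open>c\<close> independent of \<open>l\<close>.  For \<open>l\<close> large,
  \<open>2 x = 2 (k + 1) (r\<^sub>k x)\<close> is then a summand of \<open>2 (k + 1) c (r\<^sub>l x)\<close>, hence of
  \<open>(l + 1) (r\<^sub>l x) = x\<close>.\<close>

lemma absorbs_double:
  assumes x: "x \<in> carrier M" "x \<noteq> \<zero>\<^bsub>M\<^esub>"
  shows "\<exists>z\<in>carrier M. x = x \<oplus>\<^bsub>M\<^esub> (x \<oplus>\<^bsub>M\<^esub> z)"
proof -
  have "\<exists>r\<in>carrier R. x = [Suc n] \<cdot>\<^bsub>M\<^esub> (r \<odot>\<^bsub>M\<^esub> x)" for n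
  proof -
    obtain y where "y \<in> carrier M" "x = [Suc n] \<cdot>\<^bsub>M\<^esub> y" using divisible[OF x(1), of "Suc n"] by auto
    then show ?thesis using generated_by_nonzero[OF x] by metis
  qed
  then obtain r where r: "\<And>n. r n \<in> carrier R" "\<And>n. x = [Suc n] \<cdot>\<^bsub>M\<^esub> (r n \<odot>\<^bsub>M\<^esub> x)"
    by metis
  have "finite ((\<lambda>n. supp (r n)) ` UNIV)"
    using finite_basis supp_subset by (auto intro: finite_subset[where B = "Pow B"])
  then obtain k where k: "infinite {n. supp (r n) = supp (r k)}"
    using pigeonhole_infinite[of UNIV "\<lambda>n. supp (r n)"] by auto
  obtain c where c: "\<And>y. y \<in> carrier R \<Longrightarrow> supp (r k) \<subseteq> supp y \<Longrightarrow> \<exists>z\<in>carrier R. [(c :: nat)] \<cdot> y = r k \<oplus> z"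
    using multiple_dominates[OF r(1)[of k]] by metis
  from k have "\<not> (\<forall>l\<in>{n. supp (r n) = supp (r k)}. l \<le> 2 * Suc k * c)"
    unfolding finite_nat_set_iff_bounded_le by blast
  then obtain l where "\<not> l \<le> 2 * Suc k * c" "supp (r l) = supp (r k)" by blast
  then have l: "2 * Suc k * c \<le> l" "supp (r l) = supp (r k)" by linarith+
  obtain q where q: "q \<in> carrier R" "[c] \<cdot> r l = r k \<oplus> q"
    using c[OF r(1)[of l]] l by auto
  define u where "u = r l \<odot>\<^bsub>M\<^esub> x"
  define v where "v = r k \<odot>\<^bsub>M\<^esub> x"
  define w where "w = q \<odot>\<^bsub>M\<^esub> x"
  have uvw: "u \<in> carrier M" "v \<in> carrier M" "w \<in> carrier M"
    using x q r by (auto simp: u_def v_def w_def smult_closed)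
  have cu: "[c] \<cdot>\<^bsub>M\<^esub> u = v \<oplus>\<^bsub>M\<^esub> w"
    using x q r by (simp add: u_def v_def w_def add_pow_smult[symmetric] smult_l_distr)
  have xu: "x = [Suc l] \<cdot>\<^bsub>M\<^esub> u" and xv: "x = [Suc k] \<cdot>\<^bsub>M\<^esub> v"
    using r(2) by (simp_all only: u_def v_def)
  define z where "z = [(2 * Suc k)] \<cdot>\<^bsub>M\<^esub> w \<oplus>\<^bsub>M\<^esub> [(Suc l - 2 * Suc k * c)] \<cdot>\<^bsub>M\<^esub> u"
  have zM: "z \<in> carrier M" using uvw by (simp add: z_def)
  have "x = [(c * (2 * Suc k) + (Suc l - 2 * Suc k * c))] \<cdot>\<^bsub>M\<^esub> u"
    using xu l by (simp add: mult_ac)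
  also have "\<dots> = [(2 * Suc k)] \<cdot>\<^bsub>M\<^esub> ([c] \<cdot>\<^bsub>M\<^esub> u) \<oplus>\<^bsub>M\<^esub> [(Suc l - 2 * Suc k * c)] \<cdot>\<^bsub>M\<^esub> u"
    using uvw by (simp only: M.add.nat_pow_pow M.add.nat_pow_mult)
  also have "\<dots> = [(2 * Suc k)] \<cdot>\<^bsub>M\<^esub> v \<oplus>\<^bsub>M\<^esub> z"
    using uvw by (simp only: cu z_def M.add.nat_pow_distrib M.a_assoc M.add.nat_pow_closed M.a_closed)
  also have "[(2 * Suc k)] \<cdot>\<^bsub>M\<^esub> v = x \<oplus>\<^bsub>M\<^esub> x"
    using uvw xv by (simp only: mult_2 M.add.nat_pow_mult[symmetric])
  finally have "x = x \<oplus>\<^bsub>M\<^esub> (x \<oplus>\<^bsub>M\<^esub> z)"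
    using x zM by (simp add: M.a_assoc)
  then show ?thesis using zM by blast
qed

lemma nonzero_element: "\<exists>x\<in>carrier M. x \<noteq> \<zero>\<^bsub>M\<^esub>"
  using minimal M.zero_closed unfolding minimal_semimodule_def by blast

text \<open>From \<open>y = y + (y + z)\<close> the element \<open>y + z\<close> is idempotent, and it is non-zero as \<open>M\<close> is
  zero-sum-free; the idempotents form a subsemimodule.\<close>

lemma add_idempotent:
  assumes "x \<in> carrier M"
  shows "x \<oplus>\<^bsub>M\<^esub> x = x"
proof -
  obtain y where y: "y \<in> carrier M" "y \<noteq> \<zero>\<^bsub>M\<^esub>" using nonzero_element by blast
  then obtain z where z: "z \<in> carrier M" "y = y \<oplus>\<^bsub>M\<^esub> (y \<oplus>\<^bsub>M\<^esub> z)" using absorbs_double by blast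
  define e where "e = y \<oplus>\<^bsub>M\<^esub> z"
  have e: "e \<in> carrier M" "e \<noteq> \<zero>\<^bsub>M\<^esub>"
    using y z zero_sum_free[of y z] by (auto simp: e_def)
  have "e \<oplus>\<^bsub>M\<^esub> e = (y \<oplus>\<^bsub>M\<^esub> (y \<oplus>\<^bsub>M\<^esub> z)) \<oplus>\<^bsub>M\<^esub> z"
    unfolding e_def using y z(1) by (simp only: M.a_ac M.a_closed)
  also have "\<dots> = e" using z(2) by (simp add: e_def)
  finally have ee: "e \<oplus>\<^bsub>M\<^esub> e = e" .
  define N where "N = {x \<in> carrier M. x \<oplus>\<^bsub>M\<^esub> x = x}"
  have "subsemimodule N R M"
  proof (rule subsemimoduleI)
    show "N \<subseteq> carrier M" "\<zero>\<^bsub>M\<^esub> \<in> N" by (auto simp: N_def)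
  next
    fix u v assume uv: "u \<in> N" "v \<in> N"
    then have "u \<in> carrier M" "v \<in> carrier M" by (simp_all add: N_def)
    then have "(u \<oplus>\<^bsub>M\<^esub> v) \<oplus>\<^bsub>M\<^esub> (u \<oplus>\<^bsub>M\<^esub> v) = (u \<oplus>\<^bsub>M\<^esub> u) \<oplus>\<^bsub>M\<^esub> (v \<oplus>\<^bsub>M\<^esub> v)"
      by (simp add: M.a_ac)
    then show "u \<oplus>\<^bsub>M\<^esub> v \<in> N" using uv by (simp add: N_def)
  next
    fix r u assume "r \<in> carrier R" "u \<in> N"
    then show "r \<odot>\<^bsub>M\<^esub> u \<in> N" by (simp add: N_def smult_r_distr[symmetric] smult_closed)
  qed
  moreover have "e \<in> N" using e ee by (simp add: N_def)
  ultimately have "N = carrier M" using e subsemimodule_eq_carrier by blast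
  then show ?thesis using assms by (auto simp: N_def)
qed

text \<open>In an idempotent semimodule \<open>s x\<close> equals all its positive multiples, and \<open>r x\<close> is a summand of one
  of them.\<close>

lemma smult_absorbs:
  assumes "r \<in> carrier R" "s \<in> carrier R" "supp r \<subseteq> supp s" "x \<in> carrier M"
  shows "s \<odot>\<^bsub>M\<^esub> x = r \<odot>\<^bsub>M\<^esub> x \<oplus>\<^bsub>M\<^esub> s \<odot>\<^bsub>M\<^esub> x"
proof -
  obtain n q where q: "q \<in> carrier R" "[(n :: nat)] \<cdot> s = r \<oplus> q"
    using multiple_dominates[OF assms(1)] assms by metis
  have idem: "[Suc m] \<cdot>\<^bsub>M\<^esub> y = y" if "y \<in> carrier M" for m y
    using that by (induction m) (auto simp: add_idempotent)
  have "s \<odot>\<^bsub>M\<^esub> x = [Suc n] \<cdot>\<^bsub>M\<^esub> (s \<odot>\<^bsub>M\<^esub> x)" using assms idem smult_closed by simp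
  also have "\<dots> = (r \<oplus> q) \<odot>\<^bsub>M\<^esub> x \<oplus>\<^bsub>M\<^esub> s \<odot>\<^bsub>M\<^esub> x"
    using assms q(1) by (simp add: q(2)[symmetric] add_pow_smult)
  also have "\<dots> = r \<odot>\<^bsub>M\<^esub> x \<oplus>\<^bsub>M\<^esub> (q \<odot>\<^bsub>M\<^esub> x \<oplus>\<^bsub>M\<^esub> s \<odot>\<^bsub>M\<^esub> x)"
    using assms q(1) by (simp add: smult_l_distr smult_closed M.a_assoc)
  finally have *: "s \<odot>\<^bsub>M\<^esub> x = r \<odot>\<^bsub>M\<^esub> x \<oplus>\<^bsub>M\<^esub> (q \<odot>\<^bsub>M\<^esub> x \<oplus>\<^bsub>M\<^esub> s \<odot>\<^bsub>M\<^esub> x)" .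
  have c: "r \<odot>\<^bsub>M\<^esub> x \<in> carrier M" "q \<odot>\<^bsub>M\<^esub> x \<oplus>\<^bsub>M\<^esub> s \<odot>\<^bsub>M\<^esub> x \<in> carrier M"
    using assms q smult_closed by auto
  have "r \<odot>\<^bsub>M\<^esub> x \<oplus>\<^bsub>M\<^esub> s \<odot>\<^bsub>M\<^esub> x =
      (r \<odot>\<^bsub>M\<^esub> x \<oplus>\<^bsub>M\<^esub> r \<odot>\<^bsub>M\<^esub> x) \<oplus>\<^bsub>M\<^esub> (q \<odot>\<^bsub>M\<^esub> x \<oplus>\<^bsub>M\<^esub> s \<odot>\<^bsub>M\<^esub> x)"
    by (subst *) (simp only: M.a_assoc[OF c(1) c(1) c(2)])
  then show ?thesis using * c by (simp add: add_idempotent)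
qed

lemma smult_cong_supp:
  assumes "r \<in> carrier R" "s \<in> carrier R" "supp r = supp s" "x \<in> carrier M"
  shows "r \<odot>\<^bsub>M\<^esub> x = s \<odot>\<^bsub>M\<^esub> x"
proof -
  have "r \<odot>\<^bsub>M\<^esub> x = s \<odot>\<^bsub>M\<^esub> x \<oplus>\<^bsub>M\<^esub> r \<odot>\<^bsub>M\<^esub> x"
    using assms by (intro smult_absorbs) auto
  also have "\<dots> = r \<odot>\<^bsub>M\<^esub> x \<oplus>\<^bsub>M\<^esub> s \<odot>\<^bsub>M\<^esub> x"
    using assms by (intro M.a_comm smult_closed)
  also have "\<dots> = s \<odot>\<^bsub>M\<^esub> x"
    using assms by (intro smult_absorbs[symmetric]) auto
  finally show ?thesis .
qed

lemma smult_eq_zero_if_supp: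
  assumes "r \<in> carrier R" "x \<in> carrier M" "\<And>b. b \<in> supp r \<Longrightarrow> b \<odot>\<^bsub>M\<^esub> x = \<zero>\<^bsub>M\<^esub>"
  shows "r \<odot>\<^bsub>M\<^esub> x = \<zero>\<^bsub>M\<^esub>"
  using assms(1)
proof (induction r rule: supp_induct)
  case (add u v)
  then show ?case using assms(2) by (simp add: smult_l_distr)
qed (use assms(2,3) in \<open>simp_all add: smult_l_null\<close>)

text \<open>Minimising the number of basis elements above \<open>a\<close> yields an element maximal for the pre-order.\<close>

lemma exists_maximal_acting:
  obtains a x0 where "a \<in> B" "x0 \<in> carrier M" "a \<odot>\<^bsub>M\<^esub> x0 \<noteq> \<zero>\<^bsub>M\<^esub>"
    "\<And>c x. c \<in> B \<Longrightarrow> left_le R B a c \<Longrightarrow> \<not> left_le R B c a \<Longrightarrow> x \<in> carrier M \<Longrightarrow> c \<odot>\<^bsub>M\<^esub> x = \<zero>\<^bsub>M\<^esub>"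
proof -
  define A where "A = {a \<in> B. \<exists>x\<in>carrier M. a \<odot>\<^bsub>M\<^esub> x \<noteq> \<zero>\<^bsub>M\<^esub>}"
  define up where "up a = card {c \<in> B. left_le R B a c}" for a
  have "\<exists>a. a \<in> A"
  proof (rule ccontr)
    assume "\<nexists>a. a \<in> A"
    then have ann: "b \<odot>\<^bsub>M\<^esub> x = \<zero>\<^bsub>M\<^esub>" if "b \<in> B" "x \<in> carrier M" for b x
      using that unfolding A_def by blast
    have "\<one> \<odot>\<^bsub>M\<^esub> x = \<zero>\<^bsub>M\<^esub>" if "x \<in> carrier M" for x
      by (rule smult_eq_zero_if_supp) (use that ann supp_subset[of \<one>] in auto)
    then show False using nonzero_element smult_one by auto
  qed
  then obtain a where a: "a \<in> A" "\<And>c. c \<in> A \<Longrightarrow> up a \<le> up c"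
    using ex_has_least_nat[of "\<lambda>a. a \<in> A" _ up] by blast
  then obtain x0 where x0: "x0 \<in> carrier M" "a \<odot>\<^bsub>M\<^esub> x0 \<noteq> \<zero>\<^bsub>M\<^esub>" by (auto simp: A_def)
  have aB: "a \<in> B" using a by (simp add: A_def)
  have "c \<odot>\<^bsub>M\<^esub> x = \<zero>\<^bsub>M\<^esub>"
    if c: "c \<in> B" "left_le R B a c" "\<not> left_le R B c a" and x: "x \<in> carrier M" for c x
  proof (rule ccontr)
    assume "c \<odot>\<^bsub>M\<^esub> x \<noteq> \<zero>\<^bsub>M\<^esub>"
    then have "up a \<le> up c" using a c x by (auto simp: A_def)
    moreover have "{d \<in> B. left_le R B c d} \<subset> {d \<in> B. left_le R B a d}"
      using c aB left_le_trans[of a c] left_le_refl[of a] by blast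
    then have "up c < up a" unfolding up_def using finite_basis by (intro psubset_card_mono) auto
    ultimately show False by simp
  qed
  then show ?thesis using that aB x0 by blast
qed

text \<open>The homomorphism sends the class of \<open>r\<close> to \<open>r x\<^sub>0\<close>.  It respects the truncated action on the cell
  semimodule because the terms that are cut off annihilate \<open>x\<^sub>0\<close>.\<close>

lemma isomorphic_to_quotient_of_cell_semimodule:
  "\<exists>L\<in>left_cells R B. \<exists>\<theta>. semimodule_congruence R (cell_semimodule R B L) \<theta> \<and>
     semimodule_iso R M (quot_semimodule (cell_semimodule R B L) \<theta>) \<noteq> {}"
proof -
  obtain a x0 where a: "a \<in> B" and x0: "x0 \<in> carrier M" "a \<odot>\<^bsub>M\<^esub> x0 \<noteq> \<zero>\<^bsub>M\<^esub>"
    and above: "\<And>c x. c \<in> B \<Longrightarrow> left_le R B a c \<Longrightarrow> \<not> left_le R B c a \<Longrightarrow> x \<in> carrier M \<Longrightarrow>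
      c \<odot>\<^bsub>M\<^esub> x = \<zero>\<^bsub>M\<^esub>"
    using exists_maximal_acting by blast
  define L where "L = {b \<in> B. left_le R B a b \<and> left_le R B b a}"
  have L: "L \<in> left_cells R B" using a by (auto simp: left_cell_iff L_def)
  note LB = left_cell_subset[OF L]
  let ?C = "cell_semimodule R B L"
  \<comment> \<open>Any representative of the class will do, as the action depends only on supports.\<close>
  define \<phi> where "\<phi> X = (SOME r. r \<in> X) \<odot>\<^bsub>M\<^esub> x0" for X
  have \<phi>: "\<phi> (supp_class (supp r)) = r \<odot>\<^bsub>M\<^esub> x0" if "r \<in> carrier R" for r
  proof -
    have "r \<in> supp_class (supp r)" using that by (simp add: supp_class_def)
    then have "(SOME s. s \<in> supp_class (supp r)) \<in> supp_class (supp r)" by (rule someI)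
    then show ?thesis
      unfolding \<phi>_def using that x0 by (intro smult_cong_supp) (simp_all add: supp_class_def)
  qed
  have \<phi>_sum: "\<phi> (supp_class S) = sum_of S \<odot>\<^bsub>M\<^esub> x0" if "S \<subseteq> B" for S
    using \<phi>[of "sum_of S"] that by (simp add: supp_sum_of)
  have part: "\<phi> (supp_class (L \<inter> supp (r \<otimes> s))) = (r \<otimes> s) \<odot>\<^bsub>M\<^esub> x0"
    if rs: "r \<in> carrier R" "s \<in> carrier R" "supp s \<subseteq> L" for r s
  proof -
    define p where "p = sum_of (L \<inter> supp (r \<otimes> s))"
    define q where "q = sum_of (supp (r \<otimes> s) - L)"
    have sub: "L \<inter> supp (r \<otimes> s) \<subseteq> B" "supp (r \<otimes> s) - L \<subseteq> B" using supp_subset by auto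
    then have pq: "p \<in> carrier R" "q \<in> carrier R" "supp p = L \<inter> supp (r \<otimes> s)"
      "supp q = supp (r \<otimes> s) - L"
      by (simp_all add: p_def q_def supp_sum_of)
    have "supp (p \<oplus> q) = supp (r \<otimes> s)" using pq by (auto simp: supp_add)
    then have "(r \<otimes> s) \<odot>\<^bsub>M\<^esub> x0 = (p \<oplus> q) \<odot>\<^bsub>M\<^esub> x0"
      using pq rs x0 by (intro smult_cong_supp) auto
    also have "\<dots> = p \<odot>\<^bsub>M\<^esub> x0 \<oplus>\<^bsub>M\<^esub> q \<odot>\<^bsub>M\<^esub> x0" using pq x0 by (simp add: smult_l_distr)
    also have "q \<odot>\<^bsub>M\<^esub> x0 = \<zero>\<^bsub>M\<^esub>"
    proof (rule smult_eq_zero_if_supp)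
      fix c assume "c \<in> supp q"
      then have c: "c \<in> supp (r \<otimes> s)" "c \<notin> L" using pq by auto
      have cB: "c \<in> B" using c supp_subset by blast
      obtain b where b: "b \<in> L" "c \<in> supp (r \<otimes> b)"
        using c rs by (auto simp: supp_mult_right[of r s])
      then have "b \<in> B" "left_le R B a b" "left_le R B b c"
        using rs cB by (auto simp: L_def left_le_iff_supp)
      then have "left_le R B a c" using left_le_trans a cB by blast
      then show "c \<odot>\<^bsub>M\<^esub> x0 = \<zero>\<^bsub>M\<^esub>" using above c cB x0 by (simp add: L_def)
    qed (use pq x0 in auto)
    also have "p \<odot>\<^bsub>M\<^esub> x0 = \<phi> (supp_class (L \<inter> supp (r \<otimes> s)))"
      unfolding p_def using sub by (simp add: \<phi>_sum)
    finally show ?thesis using \<phi>_sum[OF sub(1)] x0 sub by (simp add: smult_closed)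
  qed
  have "\<exists>\<theta>. semimodule_congruence R ?C \<theta> \<and> semimodule_iso R M (quot_semimodule ?C \<theta>) \<noteq> {}"
  proof (rule first_isomorphism)
    show "semimodule R ?C" using L by (rule semimodule_cell_semimodule)
    show "semimodule R M" by (rule semimodule_axioms)
    show "\<phi> \<zero>\<^bsub>?C\<^esub> = \<zero>\<^bsub>M\<^esub>"
      using \<phi>[of \<zero>] x0 by (simp add: zero_cell_semimodule supp_zero smult_l_null)
  next
    fix X Y assume "X \<in> carrier ?C" "Y \<in> carrier ?C"
    then obtain S T where "S \<subseteq> L" "T \<subseteq> L" "X = supp_class S" "Y = supp_class T"
      using LB by (auto simp: carrier_cell_semimodule)
    moreover from this have "S \<subseteq> B" "T \<subseteq> B" using LB by auto
    ultimately show "\<phi> (X \<oplus>\<^bsub>?C\<^esub> Y) = \<phi> X \<oplus>\<^bsub>M\<^esub> \<phi> Y"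
      using \<phi>[of "sum_of S \<oplus> sum_of T"] x0
      by (simp add: add_cell_semimodule \<phi>_sum supp_add supp_sum_of smult_l_distr)
  next
    fix r X assume r: "r \<in> carrier R" and "X \<in> carrier ?C"
    then obtain S where S: "S \<subseteq> L" "X = supp_class S"
      using LB by (auto simp: carrier_cell_semimodule)
    then have SB: "S \<subseteq> B" using LB by auto
    have "(\<Union>b\<in>S. supp (r \<otimes> b)) = supp (r \<otimes> sum_of S)"
      using r SB by (simp add: supp_mult_right[of r "sum_of S"] supp_sum_of)
    then show "\<phi> (r \<odot>\<^bsub>?C\<^esub> X) = r \<odot>\<^bsub>M\<^esub> \<phi> X"
      using r S SB LB x0 part[of r "sum_of S"]
      by (simp add: smult_cell_semimodule \<phi>_sum supp_sum_of smult_assoc)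
  next
    show "\<phi> ` carrier ?C = carrier M"
    proof (intro equalityI subsetI)
      fix m assume "m \<in> \<phi> ` carrier ?C"
      then obtain S where "S \<subseteq> L" "m = \<phi> (supp_class S)"
        using LB by (auto simp: carrier_cell_semimodule)
      moreover from this have "S \<subseteq> B" using LB by auto
      ultimately show "m \<in> carrier M" using x0 by (simp add: \<phi>_sum smult_closed)
    next
      fix m assume "m \<in> carrier M"
      then obtain r where r: "r \<in> carrier R" "m = r \<odot>\<^bsub>M\<^esub> (a \<odot>\<^bsub>M\<^esub> x0)"
        using generated_by_nonzero[of "a \<odot>\<^bsub>M\<^esub> x0" m] x0 a smult_closed by auto
      have "a \<in> L" using a left_le_refl by (simp add: L_def)
      then have "m = \<phi> (supp_class (L \<inter> supp (r \<otimes> a)))"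
        using r a x0 part[of r a] by (simp add: supp_basis smult_assoc)
      moreover have "supp_class (L \<inter> supp (r \<otimes> a)) \<in> carrier ?C"
        using LB by (simp add: carrier_cell_semimodule)
      ultimately show "m \<in> \<phi> ` carrier ?C" by blast
    qed
  qed
  then show ?thesis using L by blast
qed

end

section \<open>The classification\<close>

theorem theorem9p6:
  fixes R :: "('a, 'c) ring_scheme" and B :: "'a set"
  assumes "fg_nat_semiring R B"
    and "\<forall>J\<in>two_sided_cells R B. strongly_regular_cell R B J \<and> idempotent_cell R B J"
  shows "(\<forall>M :: ('a, 'm, 'd) module_scheme.
            minimal_semimodule R M \<and> proper_semimodule R M \<longrightarrow>
            (\<exists>L\<in>left_cells R B. \<exists>\<theta>.
               semimodule_congruence R (cell_semimodule R B L) \<theta> \<and>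
               semimodule_iso R M (quot_semimodule (cell_semimodule R B L) \<theta>) \<noteq> {})) \<and>
         (\<forall>L\<in>left_cells R B. \<forall>\<theta>.
            semimodule_congruence R (cell_semimodule R B L) \<theta> \<and>
            carrier (quot_semimodule (cell_semimodule R B L) \<theta>) \<noteq>
              {\<zero>\<^bsub>quot_semimodule (cell_semimodule R B L) \<theta>\<^esub>} \<longrightarrow>
            minimal_semimodule R (quot_semimodule (cell_semimodule R B L) \<theta>))"
proof -
  interpret fg_nat_semiring R B by (rule assms(1))
  have "\<exists>L\<in>left_cells R B. \<exists>\<theta>. semimodule_congruence R (cell_semimodule R B L) \<theta> \<and>
      semimodule_iso R M (quot_semimodule (cell_semimodule R B L) \<theta>) \<noteq> {}"
    if M: "minimal_semimodule R M" "proper_semimodule R M" for M :: "('a, 'm, 'd) module_scheme"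
  proof -
    interpret M: semimodule R M using M by (simp add: minimal_semimodule_def)
    interpret M: minimal_proper_semimodule R B M
      by unfold_locales (use M in \<open>simp_all add: proper_semimodule_def\<close>)
    show ?thesis by (rule M.isomorphic_to_quotient_of_cell_semimodule)
  qed
  then show ?thesis using quotient_of_cell_semimodule_minimal[OF assms(2)] by blast
qed

end
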